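(* For every integer $t\geq 0$, the generating function $\displaystyle \sum_{n\geq 1}\left|\mathrm{Pop}_{\widetilde S_n}^{-t}(e)\right|z^n$ is rational (in particular, each coefficient is finite).
   Context: For a Coxeter system $(W,S)$ with length $\ell$, right weak order $x\leq_R y$ iff $\ell(x^{-1}y)=\ell(y)-\ell(x)$ (a complete meet-semilattice with meet $\bigwedge_R$), and right descent set $D_R(w)=\{s\in S:\ell(ws)<\ell(w)\}$, define $\mathrm{Pop}_W(w)=\bigwedge_R(\{ws:s\in D_R(w)\}\cup\{w\})$; $\mathrm{Pop}_W^{-t}(e)$ is the set of $w$ with $\mathrm{Pop}_W^t(w)=e$. The affine symmetric group $\widetilde S_n$ is the group (under composition) of bijections $w:\mathbb Z\to\mathbb Z$ with $w(i+n)=w(i)+n$ for all $i$ and $\sum_{i=1}^n w(i)=\binom{n+1}{2}$; it is a Coxeter group (type $\widetilde A_{n-1}$) with simple generators $\widetilde s_1,\ldots,\widetilde s_n$, where $\widetilde s_i$ swaps $i+mn$ and $i+mn+1$ for all $m\in\mathbb Z$ and fixes all other integers. *)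

theory Defs
  imports "HOL-Algebra.Lattice" "HOL-Algebra.Group" "HOL-Number_Theory.Cong"
    "HOL-Computational_Algebra.Polynomial_FPS"
begin

text \<open>
  The notions attached to a Coxeter system are defined for an arbitrary group \<open>G\<close> with
  a set \<open>S\<close> of generators.
\<close>

definition coxeter_length :: "('a, 'b) monoid_scheme \<Rightarrow> 'a set \<Rightarrow> 'a \<Rightarrow> nat" where
  "coxeter_length G S w =
     (LEAST k. \<exists>us. length us = k \<and> set us \<subseteq> S \<and> foldr (\<lambda>x y. x \<otimes>\<^bsub>G\<^esub> y) us \<one>\<^bsub>G\<^esub> = w)"

definition right_weak_order :: "('a, 'b) monoid_scheme \<Rightarrow> 'a set \<Rightarrow> 'a gorder" where
  "right_weak_order G S =
     \<lparr>carrier = carrier G, eq = (=),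
      le = (\<lambda>x y. int (coxeter_length G S (inv\<^bsub>G\<^esub> x \<otimes>\<^bsub>G\<^esub> y)) =
                  int (coxeter_length G S y) - int (coxeter_length G S x))\<rparr>"

definition right_descents :: "('a, 'b) monoid_scheme \<Rightarrow> 'a set \<Rightarrow> 'a \<Rightarrow> 'a set" where
  "right_descents G S w =
     {s \<in> S. coxeter_length G S (w \<otimes>\<^bsub>G\<^esub> s) < coxeter_length G S w}"

definition Pop :: "('a, 'b) monoid_scheme \<Rightarrow> 'a set \<Rightarrow> 'a \<Rightarrow> 'a" where
  "Pop G S w =
     \<Sqinter>\<^bsub>right_weak_order G S\<^esub> ({w \<otimes>\<^bsub>G\<^esub> s | s. s \<in> right_descents G S w} \<union> {w})"

definition Pop_preimage :: "('a, 'b) monoid_scheme \<Rightarrow> 'a set \<Rightarrow> nat \<Rightarrow> 'a set" where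
  "Pop_preimage G S t = {w \<in> carrier G. (Pop G S ^^ t) w = \<one>\<^bsub>G\<^esub>}"

definition affine_sym :: "nat \<Rightarrow> (int \<Rightarrow> int) monoid" where
  "affine_sym n =
     \<lparr>carrier = {w. bij w \<and> (\<forall>i. w (i + int n) = w i + int n) \<and>
                    (\<Sum>i = 1..int n. w i) = int ((n + 1) choose 2)},
      monoid.mult = (\<circ>), one = id\<rparr>"

text \<open>The following is the intended involution only for \<open>n \<ge> 2\<close>.\<close>

definition affine_transposition :: "nat \<Rightarrow> int \<Rightarrow> int \<Rightarrow> int" where
  "affine_transposition n i j =
     (if [j = i] (mod int n) then j + 1
      else if [j = i + 1] (mod int n) then j - 1
      else j)"

text \<open>
  For \<open>n = 1\<close> the group is trivial and no swap of \<open>i + m\<close> with \<open>i + m + 1\<close> for all \<open>m\<close>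
  exists, so the set of simple generators is empty.
\<close>

definition affine_simple :: "nat \<Rightarrow> (int \<Rightarrow> int) set" where
  "affine_simple n = (if n \<ge> 2 then affine_transposition n ` {1..int n} else {})"

text \<open>
  \<open>F\<close> is the quotient \<open>p / q\<close> of two polynomials.  This is stated without the division of
  \<open>fps\<close>, which truncates when \<open>q\<close> does not divide \<open>p\<close> as a power series.
\<close>

definition rational_fps :: "'a::field fps \<Rightarrow> bool" where
  "rational_fps F \<longleftrightarrow> (\<exists>p q. q \<noteq> 0 \<and> F * fps_of_poly q = fps_of_poly p)"

end

theory Submission
  imports Defs
begin

text \<open>
  On affine permutations, \<open>Pop\<close> reverses every maximal descending run of the one-line
  notation: the length counts inversions modulo translation, and \<open>x \<le>\<^sub>R y\<close> holds iff the
  inversions of \<open>x\<^sup>-\<^sup>1\<close> are inversions of \<open>y\<^sup>-\<^sup>1\<close>, so the meet of the elements \<open>w s\<close> undoes exactly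
  the inversions inside descending runs.

  After one application of \<open>Pop\<close> all descending runs have at most three elements.  Hence if
  \<open>Pop\<^sup>t(w) = e\<close> with \<open>t \<ge> 1\<close>, then \<open>v = Pop(w)\<close> moves every integer by at most \<open>2(t - 1)\<close>, and \<open>w\<close>
  is determined by the \<open>n\<close>-periodic sequence of the pairs of \<open>v(i) - i\<close> and the truth value of
  \<open>w(i) > w(i + 1)\<close>.  The runs of \<open>w\<close> itself may be arbitrarily long, but because \<open>v\<close> is close to
  the identity the conditions on such a sequence are still local.  So the preimages
  correspond to the periodic points of a subshift of finite type, except for the one sequence
  in which every position is a descent, and the number of periodic points is the trace of a
  matrix power.
\<close>

section \<open>Counting periodic points of subshifts of finite type\<close>

text \<open>Encoding \<open>w\<close> by its own displacements fails: one descending run of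
  \<open>w\<close> can have length \<open>n\<close>, so \<open>w(i) - i\<close> is unbounded as
  \<open>n\<close> grows. The pair of \<open>v = Pop(w)\<close> and the descent set \<open>D\<close>
  of \<open>w\<close> loses nothing, because reversing the blocks of \<open>D\<close> once more
  turns \<open>v\<close> back into \<open>w\<close>. What must be imposed is that \<open>D\<close>
  really is the descent set of the decoded map.

  Two requirements look global. The normalisation of the sum over a period comes for free: block
  reversal is an equivariant involution, so \<open>Pop\<close> preserves and reflects membership in
  the group, and every equivariant preimage of the identity is normalised. That some position is not
  a descent cannot be seen in any window, since arbitrarily long runs occur. The only admissible
  sequence violating it has displacement 0 throughout and is a periodic point for every
  \<open>n\<close>, so the correction is the series \<open>z / (1 - z)\<close>.\<close>

definition regular_rational_fps :: "'a::field fps \<Rightarrow> bool" where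
  "regular_rational_fps F \<longleftrightarrow> (\<exists>p q. coeff q 0 \<noteq> 0 \<and> F * fps_of_poly q = fps_of_poly p)"

lemma regular_rational_fps_imp_rational: "regular_rational_fps F \<Longrightarrow> rational_fps F"
  unfolding regular_rational_fps_def rational_fps_def by (metis coeff_0)

lemma regular_rational_fps_of_poly [simp, intro]: "regular_rational_fps (fps_of_poly p)"
  unfolding regular_rational_fps_def by (rule exI[of _ p], rule exI[of _ 1]) simp

lemma regular_rational_fps_const [simp, intro]: "regular_rational_fps (fps_const c)"
  using regular_rational_fps_of_poly[of "[:c:]"] by (simp add: fps_of_poly_const)

lemma regular_rational_fps_X [simp, intro]: "regular_rational_fps fps_X"
  using regular_rational_fps_of_poly[of "[:0, 1:]"] by (simp add: fps_of_poly_fps_X)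

lemma regular_rational_fps_01 [simp, intro]:
  "regular_rational_fps 0" "regular_rational_fps 1"
  using regular_rational_fps_const[of 0] regular_rational_fps_const[of 1]
  by (simp_all del: regular_rational_fps_const)

lemma regular_rational_fps_add:
  assumes "regular_rational_fps F" "regular_rational_fps G"
  shows "regular_rational_fps (F + G)"
proof -
  from assms obtain p q p' q' where q: "coeff q 0 \<noteq> 0" "coeff q' 0 \<noteq> 0"
    and p: "F * fps_of_poly q = fps_of_poly p" "G * fps_of_poly q' = fps_of_poly p'"
    unfolding regular_rational_fps_def by blast
  have "(F + G) * fps_of_poly (q * q') =
    (F * fps_of_poly q) * fps_of_poly q' + (G * fps_of_poly q') * fps_of_poly q"
    by (simp add: fps_of_poly_mult algebra_simps)
  also have "\<dots> = fps_of_poly (p * q' + p' * q)"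
    by (simp add: p fps_of_poly_mult fps_of_poly_add)
  finally show ?thesis
    using q unfolding regular_rational_fps_def by (metis coeff_mult_0 mult_eq_0_iff)
qed

lemma regular_rational_fps_mult:
  assumes "regular_rational_fps F" "regular_rational_fps G"
  shows "regular_rational_fps (F * G)"
proof -
  from assms obtain p q p' q' where q: "coeff q 0 \<noteq> 0" "coeff q' 0 \<noteq> 0"
    and p: "F * fps_of_poly q = fps_of_poly p" "G * fps_of_poly q' = fps_of_poly p'"
    unfolding regular_rational_fps_def by blast
  have "(F * G) * fps_of_poly (q * q') = (F * fps_of_poly q) * (G * fps_of_poly q')"
    by (simp add: fps_of_poly_mult algebra_simps)
  also have "\<dots> = fps_of_poly (p * p')"
    by (simp add: p fps_of_poly_mult)
  finally show ?thesis
    using q unfolding regular_rational_fps_def by (metis coeff_mult_0 mult_eq_0_iff)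
qed

lemma regular_rational_fps_diff:
  assumes "regular_rational_fps F" "regular_rational_fps G"
  shows "regular_rational_fps (F - G)"
proof -
  have "F - G = F + fps_const (-1) * G"
    by (simp flip: fps_const_neg)
  then show ?thesis
    using regular_rational_fps_add[OF assms(1)]
      regular_rational_fps_mult[OF regular_rational_fps_const assms(2)]
    by metis
qed

lemma regular_rational_fps_sum:
  assumes "\<And>i. i \<in> I \<Longrightarrow> regular_rational_fps (f i)"
  shows "regular_rational_fps (\<Sum>i\<in>I. f i)"
  using assms by (induction I rule: infinite_finite_induct) (auto intro: regular_rational_fps_add)

text \<open>Numerator and denominator swap roles. The old numerator is admissible as a denominator
  because its constant term is the product of those of \<open>F\<close> and
  \<open>q\<close>.\<close>

lemma regular_rational_fps_inverse:
  assumes "regular_rational_fps F" "fps_nth F 0 \<noteq> 0"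
  shows "regular_rational_fps (inverse F)"
proof -
  from assms obtain p q where q: "coeff q 0 \<noteq> 0" and p: "F * fps_of_poly q = fps_of_poly p"
    unfolding regular_rational_fps_def by blast
  have "inverse F * fps_of_poly p = (inverse F * F) * fps_of_poly q"
    by (simp add: p[symmetric] mult.assoc)
  then have "inverse F * fps_of_poly p = fps_of_poly q"
    using assms(2) by (simp add: inverse_mult_eq_1)
  moreover have "coeff p 0 \<noteq> 0"
  proof -
    have "coeff p 0 = fps_nth (F * fps_of_poly q) 0" by (simp add: p)
    then show ?thesis using q assms(2) by simp
  qed
  ultimately show ?thesis
    unfolding regular_rational_fps_def by blast
qed

text \<open>Gaussian elimination. The pivot \<open>1 - a k k\<close> is a unit because
  \<open>a k k\<close> has constant term 0. Substituting the solved unknown \<open>f k\<close> into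
  the other equations keeps all coefficients rational and the matrix entries without constant term,
  so the induction hypothesis applies to a new \<open>c\<close> and \<open>a\<close> with the same
  \<open>f\<close>.\<close>

lemma regular_rational_fps_linear_system:
  assumes "finite I"
    and "\<And>i. i \<in> I \<Longrightarrow> regular_rational_fps (c i)"
    and "\<And>i j. i \<in> I \<Longrightarrow> j \<in> I \<Longrightarrow> regular_rational_fps (a i j) \<and> fps_nth (a i j) 0 = 0"
    and "\<And>i. i \<in> I \<Longrightarrow> f i = c i + (\<Sum>j\<in>I. a i j * f j)"
    and "i \<in> I"
  shows "regular_rational_fps (f i)"
  using assms
proof (induction I arbitrary: c a i rule: finite_induct)
  case (insert k I)
  define g where "g = inverse (1 - a k k)"
  have rat: "regular_rational_fps (a i j)" "fps_nth (a i j) 0 = 0"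
    if "i \<in> insert k I" "j \<in> insert k I" for i j
    using insert.prems(2) that by blast+
  have c: "regular_rational_fps (c i)" if "i \<in> insert k I" for i
    using insert.prems(1) that by blast
  have unit: "fps_nth (1 - a k k) 0 \<noteq> 0"
    by (simp add: rat)
  have g: "regular_rational_fps g"
    unfolding g_def
    by (rule regular_rational_fps_inverse[OF regular_rational_fps_diff unit]) (auto simp: rat)
  have "f k * (1 - a k k) = c k + (\<Sum>j\<in>I. a k j * f j)"
    using insert.prems(3)[of k] insert.hyps by (simp add: algebra_simps)
  then have "g * (1 - a k k) * f k = g * (c k + (\<Sum>j\<in>I. a k j * f j))"
    by (metis mult.assoc mult.commute)
  moreover have "g * (1 - a k k) = 1"
    unfolding g_def by (rule inverse_mult_eq_1[OF unit])
  ultimately have fk: "f k = g * (c k + (\<Sum>j\<in>I. a k j * f j))"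
    by simp
  have others: "regular_rational_fps (f i)" if i: "i \<in> I" for i
  proof (rule insert.IH[where c = "\<lambda>i. c i + a i k * g * c k"
        and a = "\<lambda>i j. a i j + a i k * g * a k j"])
    show "regular_rational_fps (c i + a i k * g * c k)" if "i \<in> I" for i
      using that
      by (intro regular_rational_fps_add regular_rational_fps_mult rat g c) auto
    show "regular_rational_fps (a i j + a i k * g * a k j) \<and>
        fps_nth (a i j + a i k * g * a k j) 0 = 0" if "i \<in> I" "j \<in> I" for i j
      using that
      by (intro conjI regular_rational_fps_add regular_rational_fps_mult rat g) (auto simp: rat)
    show "f i = c i + a i k * g * c k + (\<Sum>j\<in>I. (a i j + a i k * g * a k j) * f j)"
      if "i \<in> I" for i
    proof -
      have "f i = c i + a i k * f k + (\<Sum>j\<in>I. a i j * f j)"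
        using insert.prems(3)[of i] insert.hyps that by (simp add: algebra_simps)
      also have "a i k * f k = a i k * g * c k + (\<Sum>j\<in>I. a i k * g * a k j * f j)"
        by (subst fk) (simp add: algebra_simps sum_distrib_left)
      finally show ?thesis
        by (simp add: algebra_simps sum.distrib)
    qed
  qed (use i in auto)
  show ?case
  proof (cases "i = k")
    case True
    have "regular_rational_fps (g * (c k + (\<Sum>j\<in>I. a k j * f j)))"
      by (intro regular_rational_fps_add regular_rational_fps_mult regular_rational_fps_sum
          rat g c others) auto
    then show ?thesis using fk True by simp
  next
    case False
    then show ?thesis using others insert.prems by blast
  qed
qed simp

section \<open>Walks in a finite directed graph\<close>

fun walk_count :: "'s set \<Rightarrow> ('s \<Rightarrow> 's \<Rightarrow> bool) \<Rightarrow> nat \<Rightarrow> 's \<Rightarrow> 's \<Rightarrow> nat" where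
  "walk_count A E 0 a b = (if a = b then 1 else 0)"
| "walk_count A E (Suc n) a b = (\<Sum>c \<in> {c \<in> A. E a c}. walk_count A E n c b)"

text \<open>For a fixed end point \<open>b\<close> these series solve \<open>F = e + z M F\<close>,
  where \<open>M\<close> is the 0-1 adjacency matrix of \<open>E\<close> on \<open>A\<close> and
  \<open>e\<close> the unit vector at \<open>b\<close>. The factor \<open>z\<close> gives the
  vanishing constant terms that the elimination asks for.\<close>

lemma regular_rational_walk_count:
  assumes "finite A" "a \<in> A"
  shows "regular_rational_fps (Abs_fps (\<lambda>n. of_nat (walk_count A E n a b)) :: 'a::field fps)"
proof -
  define F :: "_ \<Rightarrow> 'a fps" where "F a = Abs_fps (\<lambda>n. of_nat (walk_count A E n a b))" for a
  define m :: "_ \<Rightarrow> _ \<Rightarrow> 'a fps" where "m a c = fps_const (of_bool (E a c)) * fps_X" for a c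
  have "F a = fps_const (of_bool (a = b)) + (\<Sum>c\<in>A. m a c * F c)" for a
  proof (rule fps_ext)
    fix n
    show "fps_nth (F a) n =
      fps_nth (fps_const (of_bool (a = b)) + (\<Sum>c\<in>A. m a c * F c)) n"
    proof (cases n)
      case 0
      then show ?thesis by (simp add: F_def m_def fps_sum_nth mult.assoc)
    next
      case (Suc k)
      have "(\<Sum>c \<in> {c \<in> A. E a c}. of_nat (walk_count A E k c b) :: 'a) =
          (\<Sum>c\<in>A. of_bool (E a c) * of_nat (walk_count A E k c b))"
        using assms(1) by (intro sum.mono_neutral_cong_left) auto
      then show ?thesis
        by (simp add: Suc F_def m_def fps_sum_nth mult.assoc)
    qed
  qed
  moreover have "regular_rational_fps (m a c)" "fps_nth (m a c) 0 = 0" for a c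
    unfolding m_def by (rule regular_rational_fps_mult) auto
  ultimately have "regular_rational_fps (F a)"
    using regular_rational_fps_linear_system[OF assms(1), of "\<lambda>a. fps_const (of_bool (a = b))" m F a]
      assms(2) regular_rational_fps_const by blast
  then show ?thesis by (simp add: F_def)
qed

text \<open>A walk of \<open>n\<close> steps lists \<open>n + 1\<close> vertices, so a closed walk
  repeats its start at the end.\<close>

definition walks :: "'s set \<Rightarrow> ('s \<Rightarrow> 's \<Rightarrow> bool) \<Rightarrow> nat \<Rightarrow> 's \<Rightarrow> 's \<Rightarrow> 's list set" where
  "walks A E n a b =
     {xs. length xs = Suc n \<and> set xs \<subseteq> A \<and> hd xs = a \<and> last xs = b \<and> successively E xs}"

lemma walks_Suc:
  assumes "a \<in> A"
  shows "walks A E (Suc n) a b = (\<Union>c \<in> {c \<in> A. E a c}. Cons a ` walks A E n c b)"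
proof (intro equalityI subsetI)
  fix xs assume "xs \<in> walks A E (Suc n) a b"
  then obtain c ys where "xs = a # c # ys" "length ys = n" "set (c # ys) \<subseteq> A" "E a c"
    "successively E (c # ys)" "last (c # ys) = b"
    by (auto simp: walks_def length_Suc_conv)
  then show "xs \<in> (\<Union>c \<in> {c \<in> A. E a c}. Cons a ` walks A E n c b)"
    by (auto simp: walks_def intro!: bexI[of _ c])
next
  fix xs assume "xs \<in> (\<Union>c \<in> {c \<in> A. E a c}. Cons a ` walks A E n c b)"
  then show "xs \<in> walks A E (Suc n) a b"
    using assms by (auto simp: walks_def successively_Cons)
qed

lemma card_walks:
  assumes "finite A" "a \<in> A"
  shows "finite (walks A E n a b) \<and> card (walks A E n a b) = walk_count A E n a b"
  using assms(2)
proof (induction n arbitrary: a)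
  case 0
  have "walks A E 0 a b = (if a = b then {[a]} else {})"
    using 0 by (auto simp: walks_def length_Suc_conv)
  then show ?case by simp
next
  case (Suc n)
  have disj: "Cons a ` walks A E n c b \<inter> Cons a ` walks A E n d b = {}" if "c \<noteq> d" for c d
    using that by (auto simp: walks_def)
  have "card (walks A E (Suc n) a b) =
      (\<Sum>c \<in> {c \<in> A. E a c}. card (Cons a ` walks A E n c b))"
    unfolding walks_Suc[OF Suc.prems]
    by (rule card_UN_disjoint) (use assms(1) Suc disj in auto)
  also have "\<dots> = walk_count A E (Suc n) a b"
    by (simp add: card_image Suc.IH)
  finally show ?case
    using assms(1) Suc by (auto simp: walks_Suc)
qed

section \<open>Periodic sequences as closed walks\<close>

definition periodic :: "nat \<Rightarrow> (int \<Rightarrow> 'a) \<Rightarrow> bool" where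
  "periodic n x \<longleftrightarrow> (\<forall>i. x (i + int n) = x i)"

lemma periodic_add_mult:
  assumes "periodic n x"
  shows "x (i + k * int n) = x i"
proof -
  have nat: "x (i + int m * int n) = x i" for i m
  proof (induction m)
    case (Suc m)
    have "x (i + int (Suc m) * int n) = x (i + int m * int n + int n)"
      by (simp add: algebra_simps)
    then show ?case using Suc assms by (simp add: periodic_def)
  qed simp
  show ?thesis
  proof (cases "k \<ge> 0")
    case True
    then show ?thesis using nat[of i "nat k"] by simp
  next
    case False
    then show ?thesis using nat[of "i + k * int n" "nat (- k)"] by simp
  qed
qed

lemma periodic_mod:
  assumes "periodic n x"
  shows "x (i mod int n) = x i"
  using periodic_add_mult[OF assms, of "i mod int n" "i div int n"] by (simp add: mult.commute)

definition periodic_paths :: "'s set \<Rightarrow> ('s \<Rightarrow> 's \<Rightarrow> bool) \<Rightarrow> nat \<Rightarrow> (int \<Rightarrow> 's) set" where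
  "periodic_paths A E n = {x. periodic n x \<and> (\<forall>i. x i \<in> A \<and> E (x i) (x (i + 1)))}"

text \<open>Reading a sequence at \<open>0..n\<close> records the wrap-around step from
  \<open>n - 1\<close> to \<open>n\<close> as an ordinary edge; the inverse reads the list modulo
  \<open>n\<close>.\<close>

lemma bij_betw_periodic_paths:
  assumes "n \<ge> 1"
  shows "bij_betw (\<lambda>x. map (\<lambda>k. x (int k)) [0..<Suc n])
    (periodic_paths A E n) (\<Union>a\<in>A. walks A E n a a)"
proof (rule bij_betw_byWitness[where f' = "\<lambda>xs i. xs ! nat (i mod int n)"])
  have n: "0 \<le> i mod int n" "i mod int n < int n" "nat (i mod int n) < n" for i
    using assms by (auto simp: nat_less_iff)
  show "\<forall>x\<in>periodic_paths A E n.
      (\<lambda>i. map (\<lambda>k. x (int k)) [0..<Suc n] ! nat (i mod int n)) = x"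
  proof (intro ballI ext)
    fix x i assume "x \<in> periodic_paths A E n"
    then show "map (\<lambda>k. x (int k)) [0..<Suc n] ! nat (i mod int n) = x i"
      using n[of i] by (simp add: periodic_paths_def periodic_mod del: upt_Suc)
  qed
  show "\<forall>xs\<in>\<Union>a\<in>A. walks A E n a a.
      map (\<lambda>k. xs ! nat (int k mod int n)) [0..<Suc n] = xs"
  proof (intro ballI nth_equalityI)
    fix xs j assume xs: "xs \<in> (\<Union>a\<in>A. walks A E n a a)"
      and "j < length (map (\<lambda>k. xs ! nat (int k mod int n)) [0..<Suc n])"
    then have j: "j \<le> n" by simp
    from xs have "xs \<noteq> []" "length xs = Suc n" "hd xs = last xs"
      by (auto simp: walks_def)
    then have "xs ! 0 = xs ! n"
      by (simp add: hd_conv_nth last_conv_nth)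
    then show "map (\<lambda>k. xs ! nat (int k mod int n)) [0..<Suc n] ! j = xs ! j"
      using j by (cases "j = n") (auto simp del: upt_Suc simp flip: zmod_int)
  qed (auto simp: walks_def)
  show "(\<lambda>x. map (\<lambda>k. x (int k)) [0..<Suc n]) ` periodic_paths A E n
      \<subseteq> (\<Union>a\<in>A. walks A E n a a)"
  proof (rule image_subsetI)
    fix x assume x: "x \<in> periodic_paths A E n"
    have "x (int n) = x 0"
      using x unfolding periodic_paths_def periodic_def by (metis (mono_tags, lifting) add_0 mem_Collect_eq)
    moreover have "successively E (map (\<lambda>k. x (int k)) [0..<Suc n])"
      using x by (auto simp: periodic_paths_def successively_conv_nth add.commute simp del: upt_Suc)
    ultimately have "map (\<lambda>k. x (int k)) [0..<Suc n] \<in> walks A E n (x 0) (x 0)"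
      using x by (auto simp: walks_def periodic_paths_def hd_map last_map simp del: upt_Suc)
    then show "map (\<lambda>k. x (int k)) [0..<Suc n] \<in> (\<Union>a\<in>A. walks A E n a a)"
      using x by (auto simp: periodic_paths_def)
  qed
  show "(\<lambda>xs i. xs ! nat (i mod int n)) ` (\<Union>a\<in>A. walks A E n a a) \<subseteq> periodic_paths A E n"
  proof (rule image_subsetI)
    fix xs assume "xs \<in> (\<Union>a\<in>A. walks A E n a a)"
    then have len: "length xs = Suc n" and A: "set xs \<subseteq> A" and suc: "successively E xs"
      and ends: "hd xs = last xs" "xs \<noteq> []"
      by (auto simp: walks_def)
    then have cyc: "xs ! 0 = xs ! n"
      by (simp add: hd_conv_nth last_conv_nth)
    have "E (xs ! nat (i mod int n)) (xs ! nat ((i + 1) mod int n))" for i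
    proof -
      \<comment> \<open>At the wrap-around the successor has index 0, where the list has the same
        entry as at index \<open>n\<close>.\<close>
      have succ: "xs ! nat ((i + 1) mod int n) = xs ! Suc (nat (i mod int n))"
      proof (cases "i mod int n + 1 = int n")
        case True
        then have "(i + 1) mod int n = 0"
          by (metis mod_add_left_eq mod_self)
        moreover have "Suc (nat (i mod int n)) = n"
          using True n(1)[of i] by linarith
        ultimately show ?thesis using cyc by simp
      next
        case False
        then have "(i mod int n + 1) mod int n = i mod int n + 1"
          using n(1,2)[of i] by (intro mod_pos_pos_trivial) linarith+
        then have "(i + 1) mod int n = i mod int n + 1"
          by (simp add: mod_add_left_eq)
        then show ?thesis using n(1)[of i] by (simp add: Suc_nat_eq_nat_zadd1 add.commute)
      qed
      show ?thesis
        unfolding succ using suc len n(3)[of i] by (auto simp: successively_conv_nth)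
    qed
    moreover have "xs ! nat (i mod int n) \<in> A" for i
      using A len n(3)[of i] by (auto intro: nth_mem)
    ultimately show "(\<lambda>i. xs ! nat (i mod int n)) \<in> periodic_paths A E n"
      by (auto simp: periodic_paths_def periodic_def)
  qed
qed

lemma card_periodic_paths:
  assumes "finite A" "n \<ge> 1"
  shows "finite (periodic_paths A E n)"
    and "card (periodic_paths A E n) = (\<Sum>a\<in>A. walk_count A E n a a)"
proof -
  have w: "finite (walks A E n a a)" "card (walks A E n a a) = walk_count A E n a a" if "a \<in> A" for a
    using card_walks[OF assms(1) that] by auto
  show "finite (periodic_paths A E n)"
    using bij_betw_finite[OF bij_betw_periodic_paths[OF assms(2), of A E]] assms(1) w by simp
  have "card (periodic_paths A E n) = card (\<Union>a\<in>A. walks A E n a a)"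
    by (rule bij_betw_same_card[OF bij_betw_periodic_paths[OF assms(2)]])
  also have "\<dots> = (\<Sum>a\<in>A. card (walks A E n a a))"
    by (rule card_UN_disjoint) (use assms(1) w in \<open>auto simp: walks_def\<close>)
  finally show "card (periodic_paths A E n) = (\<Sum>a\<in>A. walk_count A E n a a)"
    using w by simp
qed

text \<open>The sequences counted here are the points of period \<open>n\<close> of a subshift of finite type,
  whose number is the trace of the \<open>n\<close>-th power of a transition matrix.  The bound \<open>L\<close> is
  the radius of the window on which the constraint depends.\<close>

theorem rational_periodic_points:
  fixes P :: "(int \<Rightarrow> 'a) \<Rightarrow> int \<Rightarrow> bool"
  assumes A: "finite A"
    and shift: "\<And>x i. P x i \<longleftrightarrow> P (\<lambda>k. x (i + k)) 0"
    and local: "\<And>x y. (\<And>k. \<bar>k\<bar> \<le> L \<Longrightarrow> x k = y k) \<Longrightarrow> P x 0 \<Longrightarrow> P y 0"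
  defines "X \<equiv> \<lambda>n. {x. periodic n x \<and> (\<forall>i. x i \<in> A \<and> P x i)}"
  shows "n \<ge> 1 \<Longrightarrow> finite (X n)"
    and "regular_rational_fps (Abs_fps (\<lambda>n. if n = 0 then 0 else of_nat (card (X n))) :: 'b::field fps)"
proof -
  \<comment> \<open>The window has to contain 0, because the central letter of each block is what
    recovers the sequence.\<close>
  define L' where "L' = max L 0"
  have L': "L' \<ge> 0" "L \<le> L'" by (auto simp: L'_def)
  define B where "B = PiE {-L'..L'} (\<lambda>_. A)"
  \<comment> \<open>Higher block presentation: the vertices are the words seen through the window,
    edges join words that overlap after a shift by one, and the constraint is a condition on the
    source vertex. A word is \<open>undefined\<close> off the window, and locality transfers
    \<open>P\<close> between it and the sequence.\<close>
  define E where "E u v \<longleftrightarrow> (\<forall>k \<in> {-L'..<L'}. u (k + 1) = v k) \<and> P u 0" for u v :: "int \<Rightarrow> 'a"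
  have B: "finite B"
    unfolding B_def using A by (intro finite_PiE) auto
  define enc where "enc x i = (\<lambda>k\<in>{-L'..L'}. x (i + k))" for x :: "int \<Rightarrow> 'a" and i :: int
  have bij: "bij_betw enc (X n) (periodic_paths B E n)" for n
  proof (rule bij_betw_byWitness[where f' = "\<lambda>y i. y i 0"])
    show "\<forall>x\<in>X n. (\<lambda>i. enc x i 0) = x"
      using L' by (auto simp: enc_def)
    \<comment> \<open>Following the overlaps step by step moves any entry of a block to the centre
      of a neighbouring block.\<close>
    have window: "y i k = y (i + k) 0"
      if y: "y \<in> periodic_paths B E n" and k: "\<bar>k\<bar> \<le> L'" for y i k
    proof -
      have step: "y i (k + 1) = y (i + 1) k" if "k \<in> {-L'..<L'}" for i k
        using y that by (auto simp: periodic_paths_def E_def)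
      have pos: "int m \<le> L' \<Longrightarrow> y i (int m) = y (i + int m) 0" for m
      proof (induction m arbitrary: i)
        case (Suc m)
        then show ?case using step[of "int m" i] by (simp add: algebra_simps)
      qed simp
      have neg: "int m \<le> L' \<Longrightarrow> y i (- int m) = y (i - int m) 0" for m
      proof (induction m arbitrary: i)
        case (Suc m)
        have "y i (- int (Suc m)) = y (i - 1) (- int m)"
          using step[of "- int (Suc m)" "i - 1"] Suc.prems by simp
        also have "\<dots> = y (i - int (Suc m)) 0"
          using Suc by (simp add: algebra_simps)
        finally show ?case .
      qed simp
      show ?thesis
        using pos[of "nat k"] neg[of "nat (- k)"] k by (cases "k \<ge> 0") auto
    qed
    show "\<forall>y\<in>periodic_paths B E n. enc (\<lambda>i. y i 0) = y"
    proof (intro ballI ext)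
      fix y i k assume y: "y \<in> periodic_paths B E n"
      then have "y i \<in> B" by (simp add: periodic_paths_def)
      then show "enc (\<lambda>i. y i 0) i k = y i k"
        using window[OF y, of k i] by (auto simp: enc_def B_def PiE_def extensional_def)
    qed
    show "enc ` X n \<subseteq> periodic_paths B E n"
    proof (rule image_subsetI)
      fix x assume x: "x \<in> X n"
      have "P (enc x i) 0" for i
      proof (rule local)
        show "P (\<lambda>k. x (i + k)) 0"
          using x shift[of x i] by (auto simp: X_def)
        show "x (i + k) = enc x i k" if "\<bar>k\<bar> \<le> L" for k
          using that L' by (auto simp: enc_def)
      qed
      moreover have "enc x (i + int n) = enc x i" for i
      proof -
        have "x (i + int n + k) = x (i + k)" for k
          using x periodic_def[of n x]
          by (auto simp: X_def) (metis add.assoc add.commute)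
        then show ?thesis by (simp add: enc_def)
      qed
      ultimately show "enc x \<in> periodic_paths B E n"
        using x by (auto simp: periodic_paths_def X_def B_def E_def periodic_def enc_def algebra_simps)
    qed
    show "(\<lambda>y i. y i 0) ` periodic_paths B E n \<subseteq> X n"
    proof (rule image_subsetI)
      fix y assume y: "y \<in> periodic_paths B E n"
      have "P (\<lambda>i. y i 0) i" for i
      proof -
        have "P (\<lambda>k. y (i + k) 0) 0"
        proof (rule local)
          show "P (y i) 0" using y by (auto simp: periodic_paths_def E_def)
          show "y i k = y (i + k) 0" if "\<bar>k\<bar> \<le> L" for k
            using window[OF y, of k i] that L' by simp
        qed
        then show ?thesis using shift[of "\<lambda>i. y i 0" i] by simp
      qed
      moreover have "y i 0 \<in> A" for i
      proof -
        have "y i \<in> PiE {-L'..L'} (\<lambda>_. A)"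
          using y by (simp add: periodic_paths_def B_def)
        from PiE_mem[OF this, of 0] show ?thesis
          using L' by simp
      qed
      ultimately show "(\<lambda>i. y i 0) \<in> X n"
        using y by (simp add: X_def periodic_paths_def periodic_def)
    qed
  qed
  show "finite (X n)" if "n \<ge> 1"
    using bij_betw_finite[OF bij] card_periodic_paths(1)[OF B that] by blast
  have card: "card (X n) = (\<Sum>a\<in>B. walk_count B E n a a)" if "n \<ge> 1" for n
    using bij_betw_same_card[OF bij] card_periodic_paths(2)[OF B that] by simp
  \<comment> \<open>At \<open>n = 0\<close> the trace is \<open>card B\<close>, while the wanted
    coefficient is 0; the constant corrects this.\<close>
  have "Abs_fps (\<lambda>n. if n = 0 then 0 else of_nat (card (X n))) =
      (\<Sum>a\<in>B. Abs_fps (\<lambda>n. of_nat (walk_count B E n a a))) - fps_const (of_nat (card B) :: 'b)"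
    by (rule fps_ext) (auto simp: fps_sum_nth card)
  also have "regular_rational_fps \<dots>"
    by (intro regular_rational_fps_diff regular_rational_fps_sum regular_rational_walk_count B)
      auto
  finally show "regular_rational_fps
      (Abs_fps (\<lambda>n. if n = 0 then 0 else of_nat (card (X n))) :: 'b fps)" .
qed

section \<open>Reversing descending runs\<close>

text \<open>Membership \<open>i \<in> D\<close> ties position \<open>i\<close> to
  \<open>i + 1\<close>. The block \<open>{a..b}\<close> is therefore delimited by the non-members
  \<open>a - 1\<close> and \<open>b\<close>, and \<open>a = b\<close> describes a singleton
  block.\<close>

definition run :: "int set \<Rightarrow> int \<Rightarrow> int \<Rightarrow> bool" where
  "run D a b \<longleftrightarrow> a \<le> b \<and> a - 1 \<notin> D \<and> b \<notin> D \<and> {a..<b} \<subseteq> D"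

definition rev_runs :: "int set \<Rightarrow> int \<Rightarrow> int" where
  "rev_runs D i = (THE j. \<exists>a b. run D a b \<and> i \<in> {a..b} \<and> j = a + b - i)"

text \<open>Makes every block finite, so that the description in \<open>rev_runs\<close> picks out a
  value at every integer.\<close>

definition gappy :: "int set \<Rightarrow> bool" where
  "gappy D \<longleftrightarrow> (\<forall>i. (\<exists>j<i. j \<notin> D) \<and> (\<exists>j>i. j \<notin> D))"

lemma runD:
  assumes "run D a b"
  shows "a \<le> b" "a - 1 \<notin> D" "b \<notin> D" "a \<le> k \<Longrightarrow> k < b \<Longrightarrow> k \<in> D"
  using assms by (auto simp: run_def)

lemma run_unique:
  assumes "run D a b" "run D a' b'" "i \<in> {a..b}" "i \<in> {a'..b'}"
  shows "a = a' \<and> b = b'"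
proof -
  have "\<not> p < q" if "run D p b1" "run D q b2" "i \<in> {p..b1}" "i \<in> {q..b2}" for p q b1 b2
  proof
    assume "p < q"
    then have "q - 1 \<in> D" using that by (intro runD(4)[OF that(1)]) auto
    then show False using runD(2)[OF that(2)] by simp
  qed
  moreover have "\<not> p < q" if "run D a1 p" "run D a2 q" "i \<in> {a1..p}" "i \<in> {a2..q}" for p q a1 a2
  proof
    assume "p < q"
    then have "p \<in> D" using that by (intro runD(4)[OF that(2)]) auto
    then show False using runD(3)[OF that(1)] by simp
  qed
  ultimately show ?thesis using assms by (metis linorder_neqE)
qed

lemma rev_runs_eq:
  assumes "run D a b" "i \<in> {a..b}"
  shows "rev_runs D i = a + b - i"
  unfolding rev_runs_def
proof (rule the_equality)
  show "\<exists>a' b'. run D a' b' \<and> i \<in> {a'..b'} \<and> a + b - i = a' + b' - i"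
    using assms by blast
  show "j = a + b - i" if "\<exists>a b. run D a b \<and> i \<in> {a..b} \<and> j = a + b - i" for j
    using that run_unique[OF assms(1) _ assms(2)] by fastforce
qed

lemma run_exists:
  assumes "gappy D"
  obtains a b where "run D a b" "i \<in> {a..b}"
proof -
  define p where "p = (LEAST k. i + int k \<notin> D)"
  define q where "q = (LEAST k. i - 1 - int k \<notin> D)"
  obtain j1 j2 where j: "j1 > i - 1" "j1 \<notin> D" "j2 < i" "j2 \<notin> D"
    using assms by (meson gappy_def)
  have "\<exists>k. i + int k \<notin> D"
    using j by (intro exI[of _ "nat (j1 - i)"]) auto
  then have p: "i + int p \<notin> D"
    unfolding p_def by (rule LeastI_ex)
  have "\<exists>k. i - 1 - int k \<notin> D"
    using j by (intro exI[of _ "nat (i - 1 - j2)"]) auto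
  then have q: "i - 1 - int q \<notin> D"
    unfolding q_def by (rule LeastI_ex)
  have "k \<in> D" if "k \<in> {i - int q..<i + int p}" for k
  proof (cases "k \<ge> i")
    case True
    then have "nat (k - i) < p" using that by auto
    then have "i + int (nat (k - i)) \<in> D" unfolding p_def using not_less_Least by blast
    then show ?thesis using True by simp
  next
    case False
    then have "nat (i - 1 - k) < q" using that by auto
    then have "i - 1 - int (nat (i - 1 - k)) \<in> D" unfolding q_def using not_less_Least by blast
    then show ?thesis using False by simp
  qed
  then have "run D (i - int q) (i + int p)"
    using p q by (auto simp: run_def algebra_simps)
  then show ?thesis using that by auto
qed

lemma rev_runs_rev_runs:
  assumes "gappy D"
  shows "rev_runs D (rev_runs D i) = i"
proof -
  obtain a b where "run D a b" "i \<in> {a..b}" using run_exists[OF assms] .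
  then show ?thesis using rev_runs_eq[of D a b i] rev_runs_eq[of D a b "a + b - i"] by auto
qed

lemma rev_runs_comp_rev_runs: "gappy D \<Longrightarrow> rev_runs D \<circ> rev_runs D = id"
  by (auto simp: rev_runs_rev_runs)

lemma rev_runs_shift:
  assumes "gappy D"
  shows "rev_runs {k. i + k \<in> D} j = rev_runs D (i + j) - i"
proof -
  obtain a b where ab: "run D a b" "i + j \<in> {a..b}" using run_exists[OF assms] .
  have "{a - i..<b - i} \<subseteq> {k. i + k \<in> D}"
  proof
    fix k assume "k \<in> {a - i..<b - i}"
    then have "i + k \<in> {a..<b}" by auto
    then show "k \<in> {k. i + k \<in> D}" using ab by (auto simp: run_def)
  qed
  then have "run {k. i + k \<in> D} (a - i) (b - i)"
    using ab by (auto simp: run_def)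
  then show ?thesis
    using ab rev_runs_eq[of D a b "i + j"] rev_runs_eq[of "{k. i + k \<in> D}" "a - i" "b - i" j]
    by auto
qed

lemma gappy_Int_atLeastAtMost: "gappy (D \<inter> {p..q})"
  unfolding gappy_def
proof (intro allI conjI)
  fix i
  show "\<exists>j<i. j \<notin> D \<inter> {p..q}" by (rule exI[of _ "min (i - 1) (p - 1)"]) auto
  show "\<exists>j>i. j \<notin> D \<inter> {p..q}" by (rule exI[of _ "max (i + 1) (q + 1)"]) auto
qed

lemma rev_runs_Int:
  assumes "run D a b" "i \<in> {a..b}" "{a - 1..b} \<subseteq> W"
  shows "rev_runs (D \<inter> W) i = rev_runs D i"
proof -
  have "run (D \<inter> W) a b" using assms by (auto simp: run_def)
  then show ?thesis using assms rev_runs_eq by metis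
qed

text \<open>A member \<open>q\<close> of the truncated set ties \<open>q\<close> to
  \<open>q + 1\<close>, hence the excess by one on the right. The bound tells which values of a map
  a truncated reversal can reach.\<close>

lemma rev_runs_Int_bounds:
  "rev_runs (D \<inter> {p..q}) i \<in> {min p i..max i (q + 1)}"
proof -
  obtain a b where ab: "run (D \<inter> {p..q}) a b" "i \<in> {a..b}"
    using run_exists[OF gappy_Int_atLeastAtMost] .
  have "a \<ge> min p i"
  proof (cases "a < i")
    case True
    then have "a \<in> {p..q}" using runD(4)[OF ab(1), of a] ab(2) by auto
    then show ?thesis by auto
  qed auto
  moreover have "b \<le> max i (q + 1)"
  proof (cases "i < b")
    case True
    then have "b - 1 \<in> {p..q}" using runD(4)[OF ab(1), of "b - 1"] ab(2) by auto
    then show ?thesis by auto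
  qed auto
  ultimately show ?thesis using rev_runs_eq[OF ab] ab by auto
qed

section \<open>Descent sets and block reversal\<close>

definition descents :: "(int \<Rightarrow> int) \<Rightarrow> int set" where
  "descents w = {i. w (i + 1) < w i}"

definition pop_runs :: "(int \<Rightarrow> int) \<Rightarrow> int \<Rightarrow> int" where
  "pop_runs w = w \<circ> rev_runs (descents w)"

text \<open>Reversal mirrors adjacent pairs inside a block, so descents there become ascents of
  \<open>v\<close>. At a boundary \<open>i \<notin> D\<close> the arguments compared are the first
  position of the block ending at \<open>i\<close> and the last position of the block starting at
  \<open>i + 1\<close>. The second inequality is weak because it negates a strict descent and
  \<open>v\<close> need not be injective. This turns "\<open>D\<close> is the descent set of the
  decoded map" into a condition on each \<open>i\<close>.\<close>

lemma descents_comp_rev_runs: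
  assumes "gappy D"
  shows "descents (v \<circ> rev_runs D) = D \<longleftrightarrow>
    (\<forall>i. if i \<in> D then v i < v (i + 1) else v (rev_runs D i) \<le> v (rev_runs D (i + 1)))"
proof -
  \<comment> \<open>In a block \<open>{a..b}\<close> the pair \<open>i\<close>, \<open>i + 1\<close>
    is carried to its mirror image, whose left member is \<open>j = a + b - i - 1\<close>.\<close>
  have flip: "\<exists>j\<in>D. rev_runs D i = j + 1 \<and> rev_runs D (i + 1) = j
    \<and> rev_runs D j = i + 1 \<and> rev_runs D (j + 1) = i" if "i \<in> D" for i
  proof -
    obtain a b where ab: "run D a b" "i \<in> {a..b}" using run_exists[OF assms] .
    have "i \<noteq> b" using that ab by (auto simp: run_def)
    then have "i + 1 \<in> {a..b}" "a + b - i - 1 \<in> {a..b}" "a + b - i \<in> {a..b}" "a + b - i - 1 \<in> {a..<b}"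
      using ab by auto
    then show ?thesis
      using ab rev_runs_eq[OF ab(1)] by (intro bexI[of _ "a + b - i - 1"]) (auto simp: run_def)
  qed
  show ?thesis
  proof
    assume eq: "descents (v \<circ> rev_runs D) = D"
    show "\<forall>i. if i \<in> D then v i < v (i + 1) else v (rev_runs D i) \<le> v (rev_runs D (i + 1))"
    proof
      fix i
      show "if i \<in> D then v i < v (i + 1) else v (rev_runs D i) \<le> v (rev_runs D (i + 1))"
      proof (cases "i \<in> D")
        case True
        then obtain j where "j \<in> D" "rev_runs D j = i + 1" "rev_runs D (j + 1) = i"
          using flip by blast
        moreover have "j \<in> descents (v \<circ> rev_runs D)" using \<open>j \<in> D\<close> eq by simp
        ultimately show ?thesis using True by (simp add: descents_def)
      next
        case False
        then have "i \<notin> descents (v \<circ> rev_runs D)" using eq by simp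
        then show ?thesis using False by (simp add: descents_def)
      qed
    qed
  next
    assume R: "\<forall>i. if i \<in> D then v i < v (i + 1) else v (rev_runs D i) \<le> v (rev_runs D (i + 1))"
    have "i \<in> descents (v \<circ> rev_runs D) \<longleftrightarrow> i \<in> D" for i
    proof (cases "i \<in> D")
      case True
      then show ?thesis using flip[OF True] R by (auto simp: descents_def)
    next
      case False
      then have "v (rev_runs D i) \<le> v (rev_runs D (i + 1))" using R by metis
      then show ?thesis using False by (simp add: descents_def)
    qed
    then show "descents (v \<circ> rev_runs D) = D" by blast
  qed
qed

lemma pop_runs_comp_rev_runs: "gappy (descents w) \<Longrightarrow> pop_runs w \<circ> rev_runs (descents w) = w"
  by (simp add: pop_runs_def comp_assoc rev_runs_comp_rev_runs)

section \<open>Bounded runs, displacement and locality\<close>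

definition short_descents :: "(int \<Rightarrow> int) \<Rightarrow> bool" where
  "short_descents v \<longleftrightarrow> (\<forall>i. \<not> (v (i + 3) < v (i + 2) \<and> v (i + 2) < v (i + 1) \<and> v (i + 1) < v i))"

text \<open>Reversal makes every descending run ascending, so in a longer descending run of
  \<open>pop_runs w\<close> two adjacent interior positions would both be singleton runs of \<open>w\<close>, and \<open>w\<close>
  would descend between them.\<close>

lemma short_descents_pop_runs:
  assumes "gappy (descents w)"
  shows "short_descents (pop_runs w)"
  unfolding short_descents_def
proof (intro allI notI)
  fix i
  assume desc: "pop_runs w (i + 3) < pop_runs w (i + 2) \<and> pop_runs w (i + 2) < pop_runs w (i + 1)
    \<and> pop_runs w (i + 1) < pop_runs w i"
  have "\<forall>j \<in> descents w. pop_runs w j < pop_runs w (j + 1)"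
    using descents_comp_rev_runs[OF assms, of "pop_runs w"] pop_runs_comp_rev_runs[OF assms] by metis
  then have nD: "i \<notin> descents w" "i + 1 \<notin> descents w" "i + 2 \<notin> descents w"
    using desc by (smt (verit))+
  then have "run (descents w) (i + 1) (i + 1)" "run (descents w) (i + 2) (i + 2)"
    by (auto simp: run_def add.commute)
  from rev_runs_eq[OF this(1), of "i + 1"] rev_runs_eq[OF this(2), of "i + 2"]
  have "pop_runs w (i + 1) = w (i + 1)" "pop_runs w (i + 2) = w (i + 2)"
    by (auto simp: pop_runs_def)
  moreover have "i + 1 + 1 = i + 2" by simp
  ultimately show False using nD(2) desc unfolding descents_def mem_Collect_eq by metis
qed

lemma short_descents_gap:
  assumes "short_descents v"
  shows "\<exists>j \<in> {i..i + 2}. j \<notin> descents v"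
proof (rule ccontr)
  assume "\<not> ?thesis"
  then have "i \<in> descents v" "i + 1 \<in> descents v" "i + 2 \<in> descents v" by auto
  then have "v (i + 1) < v i" "v (i + 2) < v (i + 1)" "v (i + 3) < v (i + 2)"
    by (simp_all add: descents_def add.assoc)
  then show False using assms by (auto simp: short_descents_def)
qed

lemma short_descents_gappy:
  assumes "short_descents v"
  shows "gappy (descents v)"
  unfolding gappy_def
proof (intro allI conjI)
  fix i
  show "\<exists>j<i. j \<notin> descents v" using short_descents_gap[OF assms, of "i - 3"] by force
  show "\<exists>j>i. j \<notin> descents v" using short_descents_gap[OF assms, of "i + 1"] by force
qed

lemma short_descents_run:
  assumes "short_descents v" "run (descents v) a b"
  shows "b \<le> a + 2"
proof (rule ccontr)
  assume "\<not> ?thesis"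
  then have "{a..a + 2} \<subseteq> {a..<b}" by auto
  then show False using assms(2) short_descents_gap[OF assms(1), of a] by (auto simp: run_def)
qed

text \<open>Blocks of at most three positions move an entry by at most 2 per application, and
  shortness is inherited by the next iterate. The value \<open>v i\<close> is found in
  \<open>pop_runs v\<close> at a position \<open>j\<close> within distance 2 of
  \<open>i\<close>.\<close>

lemma displacement_bound:
  assumes "short_descents v" "(pop_runs ^^ m) v = id"
  shows "\<bar>v i - i\<bar> \<le> 2 * int m"
  using assms
proof (induction m arbitrary: v i)
  case (Suc m)
  have gap: "gappy (descents v)" by (rule short_descents_gappy[OF Suc.prems(1)])
  define j where "j = rev_runs (descents v) i"
  obtain a b where ab: "run (descents v) a b" "i \<in> {a..b}" using run_exists[OF gap] .
  then have "\<bar>j - i\<bar> \<le> 2"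
    using rev_runs_eq[OF ab] short_descents_run[OF Suc.prems(1) ab(1)] by (auto simp: j_def)
  moreover have "\<bar>pop_runs v j - j\<bar> \<le> 2 * int m"
    using Suc.prems short_descents_pop_runs[OF gap]
    by (intro Suc.IH) (auto simp: funpow_Suc_right simp del: funpow.simps)
  moreover have "pop_runs v j = v i"
    by (simp add: pop_runs_def j_def rev_runs_rev_runs[OF gap])
  ultimately show ?case by simp
qed simp

text \<open>A version of \<open>pop_runs\<close> whose value at \<open>i\<close> visibly depends only on the arguments near \<open>i\<close>.\<close>

definition local_pop :: "(int \<Rightarrow> int) \<Rightarrow> int \<Rightarrow> int" where
  "local_pop v i = v (rev_runs (descents v \<inter> {i - 3..i + 3}) i)"

text \<open>A block of at most three positions through \<open>i\<close> lies in
  \<open>{i - 2..i + 2}\<close>, and its left delimiter \<open>a - 1\<close> may sit at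
  \<open>i - 3\<close>; this is the origin of the radius 3.\<close>

lemma local_pop_eq:
  assumes "short_descents v"
  shows "local_pop v = pop_runs v"
proof
  fix i
  obtain a b where ab: "run (descents v) a b" "i \<in> {a..b}"
    using run_exists[OF short_descents_gappy[OF assms]] .
  then have "{a - 1..b} \<subseteq> {i - 3..i + 3}"
    using short_descents_run[OF assms ab(1)] by auto
  then show "local_pop v i = pop_runs v i"
    by (simp add: local_pop_def pop_runs_def rev_runs_Int[OF ab])
qed

lemma funpow_local_pop_eq:
  assumes "short_descents v"
  shows "short_descents ((pop_runs ^^ m) v) \<and> (local_pop ^^ m) v = (pop_runs ^^ m) v"
proof (induction m)
  case (Suc m)
  then show ?case
    using local_pop_eq short_descents_pop_runs[OF short_descents_gappy] by auto
qed (use assms in simp)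

text \<open>Radius 4 rather than 3, since deciding whether \<open>i + 3\<close> is a descent reads
  the value at \<open>i + 4\<close>.\<close>

lemma local_pop_cong:
  assumes "\<And>k. \<bar>k - i\<bar> \<le> 4 \<Longrightarrow> v k = v' k"
  shows "local_pop v i = local_pop v' i"
proof -
  have "k \<in> descents v \<longleftrightarrow> k \<in> descents v'" if "k \<in> {i - 3..i + 3}" for k
    using assms[of k] assms[of "k + 1"] that by (auto simp: descents_def)
  then have "descents v \<inter> {i - 3..i + 3} = descents v' \<inter> {i - 3..i + 3}" by blast
  moreover have "\<bar>rev_runs (descents v' \<inter> {i - 3..i + 3}) i - i\<bar> \<le> 4"
    using rev_runs_Int_bounds[of "descents v'" "i - 3" "i + 3" i] by auto
  ultimately show ?thesis using assms by (simp add: local_pop_def)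
qed

lemma funpow_local_pop_cong:
  assumes "\<And>k. \<bar>k - i\<bar> \<le> 4 * int m \<Longrightarrow> v k = v' k"
  shows "(local_pop ^^ m) v i = (local_pop ^^ m) v' i"
  using assms
proof (induction m arbitrary: i)
  case (Suc m)
  have "local_pop ((local_pop ^^ m) v) i = local_pop ((local_pop ^^ m) v') i"
    by (intro local_pop_cong Suc.IH Suc.prems) auto
  then show ?case by simp
qed simp

lemma local_pop_shift: "local_pop (\<lambda>k. v (i + k) - i) j = local_pop v (i + j) - i"
proof -
  have "descents (\<lambda>k. v (i + k) - i) \<inter> {j - 3..j + 3} =
      {k. i + k \<in> descents v \<inter> {i + j - 3..i + j + 3}}"
    by (auto simp: descents_def add.assoc)
  then show ?thesis
    by (simp only: local_pop_def rev_runs_shift[OF gappy_Int_atLeastAtMost]) simp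
qed

lemma funpow_local_pop_shift:
  "(local_pop ^^ m) (\<lambda>k. v (i + k) - i) = (\<lambda>j. (local_pop ^^ m) v (i + j) - i)"
  by (induction m) (auto simp: local_pop_shift)

text \<open>If a run at the ascent \<open>i\<close> reaches beyond the window, the two values compared lie
  so far apart that the bounded displacement alone decides the inequality.\<close>

lemma ascent_cond_local:
  assumes gap: "gappy D" and i: "i \<notin> D" and bound: "\<And>k. \<bar>v k - k\<bar> \<le> m"
  defines "D' \<equiv> D \<inter> {i - 2 * m..i + 2 * m}"
  shows "v (rev_runs D' i) \<le> v (rev_runs D' (i + 1)) \<longleftrightarrow> v (rev_runs D i) \<le> v (rev_runs D (i + 1))"
proof -
  have m: "m \<ge> 0" using bound[of 0] by linarith
  have far: "v a \<le> v b" if "b - a \<ge> 2 * m" for a b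
    using bound[of a] bound[of b] that by linarith
  \<comment> \<open>Because \<open>i \<notin> E\<close>, one block ends at \<open>i\<close> and the
    next starts at \<open>i + 1\<close>; reversal sends these two positions to the outer ends of the
    blocks.\<close>
  have ends: "\<exists>a b. run E a i \<and> run E (i + 1) b \<and> rev_runs E i = a \<and> rev_runs E (i + 1) = b"
    if E: "gappy E" "i \<notin> E" for E :: "int set"
  proof -
    obtain a a' where a: "run E a a'" "i \<in> {a..a'}" using run_exists[OF E(1)] .
    obtain b b' where b: "run E b b'" "i + 1 \<in> {b..b'}" using run_exists[OF E(1)] .
    have "a' = i" using runD(4)[OF a(1), of i] a(2) E(2) by fastforce
    moreover have "b = i + 1" using runD(4)[OF b(1), of i] b(2) E(2) by fastforce
    ultimately show ?thesis
      using a b rev_runs_eq[OF a] rev_runs_eq[OF b] by (intro exI[of _ a] exI[of _ b']) auto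
  qed
  obtain a b where ab: "run D a i" "run D (i + 1) b" "rev_runs D i = a" "rev_runs D (i + 1) = b"
    using ends[OF gap i] by blast
  have "gappy D'" "i \<notin> D'" using i by (auto simp: D'_def gappy_Int_atLeastAtMost)
  then obtain a' b' where ab': "run D' a' i" "run D' (i + 1) b'" "rev_runs D' i = a'" "rev_runs D' (i + 1) = b'"
    using ends by blast
  have le: "a \<le> i" "i + 1 \<le> b" "a' \<le> i" "i + 1 \<le> b'"
    using ab ab' by (auto simp: run_def)
  \<comment> \<open>Either both blocks lie in the window and truncation changes nothing, or one of
    them leaves it. In the latter case the truncated block still extends to the edge of the window,
    so \<open>far\<close> makes both inequalities true.\<close>
  consider (inside) "i - 2 * m < a" "b \<le> i + 2 * m" | (left) "a \<le> i - 2 * m" | (right) "i + 2 * m < b"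
    by linarith
  then show ?thesis
  proof cases
    case inside
    have "rev_runs D' i = rev_runs D i"
      unfolding D'_def by (rule rev_runs_Int[OF ab(1)]) (use inside le m in auto)
    moreover have "rev_runs D' (i + 1) = rev_runs D (i + 1)"
      unfolding D'_def by (rule rev_runs_Int[OF ab(2)]) (use inside le m in auto)
    ultimately show ?thesis by simp
  next
    case left
    have "a' \<le> i - 2 * m"
    proof (rule ccontr)
      assume "\<not> ?thesis"
      then have "a' - 1 \<in> D'" using left le m runD(4)[OF ab(1), of "a' - 1"] by (auto simp: D'_def)
      then show False using runD(2)[OF ab'(1)] by simp
    qed
    then have "v a \<le> v b" "v a' \<le> v b'" using left le by (auto intro!: far)
    then show ?thesis using ab ab' by simp
  next
    case right
    have "b' > i + 2 * m"
    proof (rule ccontr)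
      assume "\<not> ?thesis"
      then have "b' \<in> D'" using right le m runD(4)[OF ab(2), of b'] by (auto simp: D'_def)
      then show False using runD(3)[OF ab'(2)] by simp
    qed
    then have "v a \<le> v b" "v a' \<le> v b'" using right le by (auto intro!: far)
    then show ?thesis using ab ab' by simp
  qed
qed

section \<open>Maps commuting with translation by \<open>n\<close>\<close>

definition equivariant :: "nat \<Rightarrow> (int \<Rightarrow> int) \<Rightarrow> bool" where
  "equivariant n w \<longleftrightarrow> (\<forall>i. w (i + int n) = w i + int n)"

lemma equivariant_comp: "equivariant n u \<Longrightarrow> equivariant n w \<Longrightarrow> equivariant n (u \<circ> w)"
  by (simp add: equivariant_def)

lemma periodic_gappy:
  assumes "periodic n (\<lambda>i. i \<in> D)" "n \<ge> 1" "D \<noteq> UNIV"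
  shows "gappy D"
proof -
  obtain d where d: "d \<notin> D" using assms(3) by blast
  then have d: "d + k * int n \<notin> D" for k
    using periodic_add_mult[OF assms(1)] by simp
  show ?thesis
    unfolding gappy_def
  proof (intro allI conjI)
    fix i
    have k: "\<bar>k\<bar> \<le> \<bar>k\<bar> * int n" for k
      using assms(2) by (simp add: mult_le_cancel_left1)
    have "d - (\<bar>d - i\<bar> + 1) * int n < i"
      using k[of "\<bar>d - i\<bar> + 1"] by linarith
    moreover have "d - (\<bar>d - i\<bar> + 1) * int n \<notin> D"
      using d[of "- (\<bar>d - i\<bar> + 1)"] by (simp add: algebra_simps)
    ultimately show "\<exists>j<i. j \<notin> D" by blast
    have "d + (\<bar>d - i\<bar> + 1) * int n > i"
      using k[of "\<bar>d - i\<bar> + 1"] by linarith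
    then show "\<exists>j>i. j \<notin> D" using d by blast
  qed
qed

text \<open>If every position were a descent, then \<open>w n \<le> w 0\<close>, against
  \<open>w n = w 0 + n\<close>. So some position is an ascent, and by periodicity it recurs in both
  directions.\<close>

lemma equivariant_descents:
  assumes "equivariant n w" "n \<ge> 1"
  shows "periodic n (\<lambda>i. i \<in> descents w)" "gappy (descents w)"
proof -
  have "w (i + int n + 1) = w (i + 1) + int n" for i
    using assms(1) by (metis equivariant_def add.assoc add.commute)
  then show per: "periodic n (\<lambda>i. i \<in> descents w)"
    using assms(1) by (auto simp: periodic_def descents_def equivariant_def)
  have "descents w \<noteq> UNIV"
  proof
    assume U: "descents w = UNIV"
    have "w (int k) \<le> w 0" for k
    proof (induction k)
      case (Suc k)
      have "int k \<in> descents w" using U by simp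
      then show ?case using Suc by (simp add: descents_def add.commute)
    qed simp
    moreover have "w (0 + int n) = w 0 + int n" using assms(1) unfolding equivariant_def by blast
    ultimately show False using assms(2) by (metis add_0 add_le_same_cancel1 not_one_le_zero of_nat_le_0_iff)
  qed
  then show "gappy (descents w)" using periodic_gappy[OF per assms(2)] by blast
qed

lemma equivariant_rev_runs:
  assumes "periodic n (\<lambda>i. i \<in> D)" "gappy D"
  shows "equivariant n (rev_runs D)"
  unfolding equivariant_def
proof
  fix i
  have "{k. int n + k \<in> D} = D"
    using assms(1) by (auto simp: periodic_def add.commute)
  then show "rev_runs D (i + int n) = rev_runs D i + int n"
    using rev_runs_shift[OF assms(2), of "int n" i] by (simp add: add.commute)
qed

lemma equivariant_pop_runs:
  assumes "equivariant n w" "n \<ge> 1"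
  shows "equivariant n (pop_runs w)"
  unfolding pop_runs_def
  by (intro equivariant_comp equivariant_rev_runs assms(1) equivariant_descents[OF assms])

section \<open>Coding the preimages by sequences over a finite alphabet\<close>

definition pop_code :: "(int \<Rightarrow> int) \<Rightarrow> int \<Rightarrow> int \<times> bool" where
  "pop_code w i = (pop_runs w i - i, i \<in> descents w)"

definition code_perm :: "(int \<Rightarrow> int \<times> bool) \<Rightarrow> int \<Rightarrow> int" where
  "code_perm x i = i + fst (x i)"

definition code_descents :: "(int \<Rightarrow> int \<times> bool) \<Rightarrow> int set" where
  "code_descents x = {i. snd (x i)}"

text \<open>The clauses say, at one position each: \<open>v\<close> has only short descending runs,
  \<open>m\<close> further applications of \<open>Pop\<close> sort \<open>v\<close>, and
  \<open>D\<close> is the descent set of \<open>v\<close> with the blocks of \<open>D\<close>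
  reversed. The radius \<open>4 * m\<close> is twice the displacement bound \<open>2 * m\<close>, as
  \<open>ascent_cond_local\<close> requires.\<close>

definition valid_code :: "nat \<Rightarrow> (int \<Rightarrow> int \<times> bool) \<Rightarrow> int \<Rightarrow> bool" where
  "valid_code m x i \<longleftrightarrow>
     (let v = code_perm x; D = code_descents x; D' = D \<inter> {i - 4 * int m..i + 4 * int m} in
       \<not> (v (i + 3) < v (i + 2) \<and> v (i + 2) < v (i + 1) \<and> v (i + 1) < v i) \<and>
       (local_pop ^^ m) v i = i \<and>
       (if i \<in> D then v i < v (i + 1) else v (rev_runs D' i) \<le> v (rev_runs D' (i + 1))))"

definition code_letters :: "nat \<Rightarrow> (int \<times> bool) set" where
  "code_letters m = {- 2 * int m..2 * int m} \<times> UNIV"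

lemma valid_code_shift: "valid_code m x i \<longleftrightarrow> valid_code m (\<lambda>k. x (i + k)) 0"
proof -
  define v where "v = code_perm x"
  define D where "D = code_descents x"
  define D' where "D' = D \<inter> {i - 4 * int m..i + 4 * int m}"
  have v: "code_perm (\<lambda>k. x (i + k)) = (\<lambda>k. v (i + k) - i)"
    by (auto simp: v_def code_perm_def)
  have D: "code_descents (\<lambda>k. x (i + k)) = {k. i + k \<in> D}"
    by (simp add: D_def code_descents_def)
  have D': "{k. i + k \<in> D} \<inter> {0 - 4 * int m..0 + 4 * int m} = {k. i + k \<in> D'}"
    by (auto simp: D'_def)
  have r: "i + rev_runs {k. i + k \<in> D'} j = rev_runs D' (i + j)" for j
    using rev_runs_shift[of D' i j] by (simp add: D'_def gappy_Int_atLeastAtMost)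
  show ?thesis
    unfolding valid_code_def Let_def v D D' funpow_local_pop_shift r v_def[symmetric]
      D_def[symmetric] D'_def[symmetric]
    by (simp add: algebra_simps)
qed

text \<open>The truncated reversals reach up to \<open>4 * m + 1\<close> and the iterates of
  \<open>local_pop\<close> up to \<open>4 * m\<close>; the additional 4 also covers the argument 3
  of the first clause when \<open>m = 0\<close>.\<close>

lemma valid_code_local:
  assumes "\<And>k. \<bar>k\<bar> \<le> 4 * int m + 4 \<Longrightarrow> x k = y k" "valid_code m x 0"
  shows "valid_code m y 0"
proof -
  define L where "L = 4 * int m"
  have v: "code_perm x k = code_perm y k" if "\<bar>k\<bar> \<le> L + 4" for k
    using assms(1)[of k] that by (simp add: code_perm_def L_def)
  have vs: "code_perm x 0 = code_perm y 0" "code_perm x 1 = code_perm y 1"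
    "code_perm x 2 = code_perm y 2" "code_perm x 3 = code_perm y 3"
    by (rule v; simp add: L_def)+
  have pop: "(local_pop ^^ m) (code_perm x) 0 = (local_pop ^^ m) (code_perm y) 0"
    by (rule funpow_local_pop_cong) (rule v, simp add: L_def)
  define D where "D = code_descents y \<inter> {0 - L..0 + L}"
  have D: "code_descents x \<inter> {0 - L..0 + L} = D"
    using assms(1) by (auto simp: D_def code_descents_def L_def)
  have r: "code_perm x (rev_runs D j) = code_perm y (rev_runs D j)" if "j \<in> {0, 1}" for j
    using rev_runs_Int_bounds[of "code_descents y" "-L" L j] that
    by (intro v) (auto simp: D_def L_def)
  have "0 \<in> code_descents x \<longleftrightarrow> 0 \<in> code_descents y"
    using assms(1)[of 0] by (simp add: code_descents_def)
  then show ?thesis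
    using assms(2) r[of 0] r[of 1]
    unfolding valid_code_def Let_def L_def[symmetric] D D_def[symmetric] pop
    by (auto simp: vs split: if_splits)
qed

definition code_set :: "nat \<Rightarrow> nat \<Rightarrow> (int \<Rightarrow> int \<times> bool) set" where
  "code_set m n = {x. periodic n x \<and> (\<forall>i. x i \<in> code_letters m \<and> valid_code m x i)}"

text \<open>One application of \<open>Pop\<close> is spent on passing from \<open>w\<close> to
  \<open>v\<close>, hence \<open>Suc m\<close> on one side and \<open>m\<close> on the other.
  Decoding reverses the blocks of \<open>D\<close> in \<open>v\<close>, which makes sense as soon as
  \<open>D\<close> is gappy; by periodicity this fails only if \<open>D\<close> is
  everything.\<close>

lemma bij_betw_pop_code:
  assumes "n \<ge> 1"
  shows "bij_betw pop_code {w. equivariant n w \<and> (pop_runs ^^ Suc m) w = id}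
    (code_set m n - {\<lambda>_. (0, True)})"
proof (rule bij_betw_byWitness[where f' = "\<lambda>x. code_perm x \<circ> rev_runs (code_descents x)"])
  let ?S = "{w. equivariant n w \<and> (pop_runs ^^ Suc m) w = id}"
  let ?T = "code_set m n - {\<lambda>_. (0, True)}"
  have code: "code_perm (pop_code w) = pop_runs w" "code_descents (pop_code w) = descents w" for w
    by (auto simp: code_perm_def pop_code_def code_descents_def)
  show "\<forall>w\<in>?S. code_perm (pop_code w) \<circ> rev_runs (code_descents (pop_code w)) = w"
    using equivariant_descents(2)[OF _ assms] by (auto simp: code pop_runs_comp_rev_runs)
  show "pop_code ` ?S \<subseteq> ?T"
  proof (intro image_subsetI)
    fix w assume "w \<in> ?S"
    then have w: "equivariant n w" and pop: "(pop_runs ^^ m) (pop_runs w) = id"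
      by (auto simp: funpow_Suc_right simp del: funpow.simps)
    define v where "v = pop_runs w"
    have gap: "gappy (descents w)" and per: "periodic n (\<lambda>i. i \<in> descents w)"
      using equivariant_descents[OF w assms] by auto
    have short: "short_descents v"
      unfolding v_def by (rule short_descents_pop_runs[OF gap])
    have bound: "\<bar>v i - i\<bar> \<le> 2 * int m" for i
      by (rule displacement_bound[OF short]) (simp add: v_def pop)
    have "descents (v \<circ> rev_runs (descents w)) = descents w"
      by (simp add: v_def pop_runs_comp_rev_runs[OF gap])
    then have cond: "if i \<in> descents w then v i < v (i + 1)
        else v (rev_runs (descents w) i) \<le> v (rev_runs (descents w) (i + 1))" for i
      using descents_comp_rev_runs[OF gap] by blast
    \<comment> \<open>The displacement bound lets \<open>ascent_cond_local\<close> replace the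
      condition on whole blocks by the one on the window.\<close>
    have "valid_code m (pop_code w) i" for i
      using cond[of i] ascent_cond_local[OF gap _ bound, of i] short funpow_local_pop_eq[OF short, of m] pop
      by (auto simp: valid_code_def code v_def[symmetric] short_descents_def split: if_splits)
    moreover have "pop_code w i \<in> code_letters m" for i
      using bound[of i] by (auto simp: pop_code_def code_letters_def v_def)
    moreover have "periodic n (pop_code w)"
      using per equivariant_pop_runs[OF w assms]
      by (simp add: periodic_def pop_code_def equivariant_def)
    moreover have "pop_code w \<noteq> (\<lambda>_. (0, True))"
    proof
      assume "pop_code w = (\<lambda>_. (0, True))"
      then have "descents w = UNIV" by (auto simp: pop_code_def fun_eq_iff)
      then show False using gap by (simp add: gappy_def)
    qed
    ultimately show "pop_code w \<in> ?T" by (simp add: code_set_def)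
  qed
  have decode: "pop_code w = x \<and> w \<in> ?S"
    if x: "x \<in> ?T" and w_def: "w = code_perm x \<circ> rev_runs (code_descents x)" for x w
  proof -
    define v where "v = code_perm x"
    define D where "D = code_descents x"
    have per: "periodic n x" and valid: "valid_code m x i" and letter: "x i \<in> code_letters m" for i
      using x by (auto simp: code_set_def)
    have perD: "periodic n (\<lambda>i. i \<in> D)"
      using per by (simp add: periodic_def D_def code_descents_def)
    have v: "equivariant n v"
      using per by (simp add: periodic_def v_def code_perm_def equivariant_def)
    have bound: "\<bar>v i - i\<bar> \<le> 2 * int m" for i
      using letter[of i] by (auto simp: code_letters_def v_def code_perm_def)
    have short: "short_descents v"
      using valid by (auto simp: valid_code_def Let_def short_descents_def v_def)
    have pop: "(pop_runs ^^ m) v = id"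
      using valid funpow_local_pop_eq[OF short, of m]
      by (auto simp: valid_code_def Let_def v_def fun_eq_iff)
    \<comment> \<open>If every position is marked, \<open>v\<close> is strictly increasing, so
      \<open>pop_runs\<close> fixes it and the second clause forces \<open>v = id\<close>. The code
      is then the excluded one.\<close>
    have "D \<noteq> UNIV"
    proof
      assume D: "D = UNIV"
      then have "v i < v (i + 1)" for i
        using valid[of i] by (auto simp: valid_code_def Let_def v_def D_def)
      then have desc: "descents v = {}" by (auto simp: descents_def) (metis less_asym)
      have "rev_runs {} = id"
        using rev_runs_eq[of "{}" i i i for i] by (auto simp: run_def fun_eq_iff)
      then have "pop_runs v = v" by (simp add: pop_runs_def desc)
      then have "(pop_runs ^^ m) v = v" by (induction m) auto
      then have "v = id" using pop by simp
      then have "fst (x i) = 0" for i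
        by (metis v_def code_perm_def add_cancel_right_right id_apply)
      moreover have "snd (x i)" for i
        using D by (auto simp: D_def code_descents_def)
      ultimately have "x = (\<lambda>_. (0, True))"
        by (auto simp: fun_eq_iff prod_eq_iff)
      then show False using x by simp
    qed
    then have gap: "gappy D"
      by (rule periodic_gappy[OF perD assms])
    have "if i \<in> D then v i < v (i + 1) else v (rev_runs D i) \<le> v (rev_runs D (i + 1))" for i
      using valid[of i] ascent_cond_local[OF gap _ bound, of i]
      by (auto simp: valid_code_def Let_def v_def D_def split: if_splits)
    then have desc: "descents w = D"
      using descents_comp_rev_runs[OF gap, of v] unfolding w_def v_def[symmetric] D_def[symmetric]
      by blast
    have popw: "pop_runs w = v"
      using rev_runs_comp_rev_runs[OF gap] desc
      by (simp add: pop_runs_def w_def v_def D_def comp_assoc)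
    have "pop_code w = x"
      by (auto simp: pop_code_def popw desc fun_eq_iff prod_eq_iff v_def D_def code_perm_def code_descents_def)
    moreover have "equivariant n w"
      unfolding w_def v_def[symmetric] D_def[symmetric]
      by (intro equivariant_comp v equivariant_rev_runs perD gap)
    moreover have "(pop_runs ^^ Suc m) w = id"
      by (simp add: funpow_Suc_right popw pop del: funpow.simps)
    ultimately show ?thesis by simp
  qed
  show "\<forall>x\<in>?T. pop_code (code_perm x \<circ> rev_runs (code_descents x)) = x"
    using decode by blast
  show "(\<lambda>x. code_perm x \<circ> rev_runs (code_descents x)) ` ?T \<subseteq> ?S"
    using decode by blast
qed

text \<open>The one code without a preimage: all positions are descents.\<close>

lemma all_descents_in_code_set: "(\<lambda>_. (0, True)) \<in> code_set m n"
proof -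
  let ?x = "\<lambda>_::int. (0::int, True)"
  have v: "code_perm ?x = id" by (auto simp: code_perm_def)
  have short: "short_descents id" by (auto simp: short_descents_def)
  have "descents id = {}" by (auto simp: descents_def)
  moreover have "rev_runs {} = id"
    using rev_runs_eq[of "{}" i i i for i] by (auto simp: run_def fun_eq_iff)
  ultimately have "pop_runs id = id" by (simp add: pop_runs_def)
  then have "(pop_runs ^^ m) id = id" by (induction m) auto
  then have "(local_pop ^^ m) id = id" using funpow_local_pop_eq[OF short, of m] by simp
  then have "valid_code m ?x i" for i
    by (simp add: valid_code_def v code_descents_def)
  then show ?thesis by (simp add: code_set_def periodic_def code_letters_def)
qed

theorem rational_pop_runs_preimage:
  defines "S \<equiv> \<lambda>n t. {w. equivariant n w \<and> (pop_runs ^^ t) w = id}"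
  shows "n \<ge> 1 \<Longrightarrow> finite (S n t)"
    and "regular_rational_fps (Abs_fps (\<lambda>n. if n = 0 then 0 else of_nat (card (S n t))) :: 'a::field fps)"
proof -
  \<comment> \<open>The series \<open>z / (1 - z)\<close> serves twice: as the answer for
    \<open>t = 0\<close>, and as the contribution of the code without a preimage for
    \<open>t > 0\<close>.\<close>
  have geom: "regular_rational_fps (Abs_fps (\<lambda>n. if n = 0 then 0 else 1) :: 'a fps)"
  proof -
    have "Abs_fps (\<lambda>n. if n = 0 then 0 else 1) = fps_X * inverse (1 - fps_X :: 'a fps)"
      by (rule fps_ext) (simp flip: fps_inverse_gp' add: fps_X_mult_nth)
    also have "regular_rational_fps \<dots>"
      by (intro regular_rational_fps_mult regular_rational_fps_inverse regular_rational_fps_diff) auto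
    finally show ?thesis .
  qed
  have "(n \<ge> 1 \<longrightarrow> finite (S n t)) \<and>
    regular_rational_fps (Abs_fps (\<lambda>n. if n = 0 then 0 else of_nat (card (S n t))) :: 'a fps)" for n
  proof (cases t)
    case 0
    then have "S n t = {id}" for n
      by (auto simp: S_def equivariant_def)
    then show ?thesis using geom by (simp cong: if_cong)
  next
    case (Suc m)
    have fin: "finite (code_letters m)" by (simp add: code_letters_def)
    have fin_code: "finite (code_set m n)" if "n \<ge> 1" for n
      unfolding code_set_def
      by (rule rational_periodic_points(1)[where P = "valid_code m", OF fin valid_code_shift valid_code_local that])
    have rat: "regular_rational_fps (Abs_fps (\<lambda>n. if n = 0 then 0 else of_nat (card (code_set m n))) :: 'a fps)"
      unfolding code_set_def
      by (rule rational_periodic_points(2)[where P = "valid_code m", OF fin valid_code_shift valid_code_local])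
    have card: "card (code_set m n) = Suc (card (S n t))" "finite (S n t)" if "n \<ge> 1" for n
      using bij_betw_same_card[OF bij_betw_pop_code[OF that, of m]]
        bij_betw_finite[OF bij_betw_pop_code[OF that, of m]] fin_code[OF that]
        card_Suc_Diff1[OF fin_code[OF that] all_descents_in_code_set]
      by (auto simp: S_def Suc simp del: funpow.simps)
    have "Abs_fps (\<lambda>n. if n = 0 then 0 else of_nat (card (S n t))) =
      Abs_fps (\<lambda>n. if n = 0 then 0 else of_nat (card (code_set m n))) -
      (Abs_fps (\<lambda>n. if n = 0 then 0 else 1) :: 'a fps)"
      by (rule fps_ext) (auto simp: card)
    then show ?thesis
      using card(2) regular_rational_fps_diff[OF rat geom] by simp
  qed
  then show "n \<ge> 1 \<Longrightarrow> finite (S n t)"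
    and "regular_rational_fps (Abs_fps (\<lambda>n. if n = 0 then 0 else of_nat (card (S n t))) :: 'a fps)"
    by blast+
qed

section \<open>The weak order on the affine symmetric group\<close>

lemma equivariant_add_mult:
  assumes "equivariant n w"
  shows "w (i + k * int n) = w i + k * int n"
  using periodic_add_mult[of n "\<lambda>i. w i - i" i k] assms
  by (simp add: periodic_def equivariant_def algebra_simps)

lemma equivariant_inv:
  assumes "equivariant n w" "bij w"
  shows "equivariant n (inv_into UNIV w)"
  unfolding equivariant_def
proof
  fix i
  have "w (inv_into UNIV w i + int n) = i + int n"
    using assms by (simp add: equivariant_def bij_is_surj surj_f_inv_f)
  then show "inv_into UNIV w (i + int n) = inv_into UNIV w i + int n"
    using assms(2) by (metis bij_is_inj inv_f_f)
qed

text \<open>An equivariant injection permutes the residues modulo \<open>n\<close>; \<open>h\<close>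
  is this permutation on the representatives \<open>1..n\<close>.\<close>

lemma sum_periodic_reindex:
  fixes g :: "int \<Rightarrow> int"
  assumes "n \<ge> 1" "periodic n g" "equivariant n p" "inj p"
  shows "(\<Sum>i=1..int n. g (p i)) = (\<Sum>i=1..int n. g i)"
proof -
  define h where "h i = (p i - 1) mod int n + 1" for i
  have g: "g (p i) = g (h i)" for i
    using periodic_add_mult[OF assms(2), of "h i" "(p i - 1) div int n"]
    by (simp add: h_def algebra_simps)
  have inj: "inj_on h {1..int n}"
  proof (rule inj_onI)
    fix i j assume ij: "i \<in> {1..int n}" "j \<in> {1..int n}" and "h i = h j"
    then have "(p i - 1) mod int n = (p j - 1) mod int n" by (simp add: h_def)
    then have "int n dvd (p i - 1) - (p j - 1)" by (rule mod_eq_dvd_iff[THEN iffD1])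
    then obtain k where "p i = p j + k * int n" by (auto simp: dvd_def algebra_simps)
    then have "p i = p (j + k * int n)" by (simp add: equivariant_add_mult[OF assms(3)])
    then have i: "i = j + k * int n" using assms(4) by (simp add: inj_eq)
    have "\<bar>k * int n\<bar> < int n" using i ij by auto
    then have "k = 0" using assms(1) by (simp add: abs_mult mult_less_cancel_right1)
    then show "i = j" using i by simp
  qed
  moreover have "h ` {1..int n} \<subseteq> {1..int n}"
    using assms(1) by (auto simp: h_def add1_zle_eq)
  ultimately have "h ` {1..int n} = {1..int n}"
    by (intro endo_inj_surj) auto
  then have "(\<Sum>i=1..int n. g i) = (\<Sum>i=1..int n. g (h i))"
    using sum.reindex[OF inj, of g] by simp
  then show ?thesis by (simp add: g)
qed

text \<open>Measuring against the identity makes the summand periodic, so that the sum condition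
  becomes the kernel of a homomorphism to the integers.\<close>

definition shift_sum :: "nat \<Rightarrow> (int \<Rightarrow> int) \<Rightarrow> int" where
  "shift_sum n w = (\<Sum>i=1..int n. w i - i)"

lemma shift_sum_comp:
  assumes "n \<ge> 1" "equivariant n u" "equivariant n p" "inj p"
  shows "shift_sum n (u \<circ> p) = shift_sum n u + shift_sum n p"
proof -
  have "periodic n (\<lambda>i. u i - i)"
    using assms(2) by (simp add: periodic_def equivariant_def)
  from sum_periodic_reindex[OF assms(1) this assms(3,4)]
  have "(\<Sum>i=1..int n. u (p i) - p i) = shift_sum n u" by (simp add: shift_sum_def)
  then show ?thesis by (simp add: shift_sum_def sum_subtractf)
qed

lemma sum_ints_eq_choose: "(\<Sum>i=1..int n. i) = int ((n + 1) choose 2)"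
proof (induction n)
  case (Suc n)
  have "{1..int (Suc n)} = insert (int n + 1) {1..int n}" by auto
  then show ?case using Suc by (simp add: numeral_2_eq_2)
qed (simp add: numeral_2_eq_2)

lemma carrier_affine_sym:
  "w \<in> carrier (affine_sym n) \<longleftrightarrow> bij w \<and> equivariant n w \<and> shift_sum n w = 0"
  by (auto simp: affine_sym_def equivariant_def shift_sum_def sum_subtractf sum_ints_eq_choose)

lemma mult_affine_sym [simp]: "x \<otimes>\<^bsub>affine_sym n\<^esub> y = x \<circ> y"
  by (simp add: affine_sym_def)

lemma one_affine_sym [simp]: "\<one>\<^bsub>affine_sym n\<^esub> = id"
  by (simp add: affine_sym_def)

lemma comp_in_affine_sym:
  assumes "n \<ge> 1" "x \<in> carrier (affine_sym n)" "y \<in> carrier (affine_sym n)"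
  shows "x \<circ> y \<in> carrier (affine_sym n)"
  using assms shift_sum_comp[of n x y]
  by (auto simp: carrier_affine_sym equivariant_comp bij_comp bij_is_inj)

lemma id_in_affine_sym: "id \<in> carrier (affine_sym n)"
  by (simp add: carrier_affine_sym equivariant_def shift_sum_def)

lemma inv_in_affine_sym:
  assumes "n \<ge> 1" "w \<in> carrier (affine_sym n)"
  shows "inv_into UNIV w \<in> carrier (affine_sym n)"
proof -
  have w: "bij w" "equivariant n w" "shift_sum n w = 0"
    using assms(2) by (auto simp: carrier_affine_sym)
  have i: "bij (inv_into UNIV w)" "equivariant n (inv_into UNIV w)"
    using w equivariant_inv by (auto simp: bij_imp_bij_inv)
  have "shift_sum n (w \<circ> inv_into UNIV w) = shift_sum n (inv_into UNIV w)"
    using shift_sum_comp[OF assms(1) w(2) i(2) bij_is_inj[OF i(1)]] w(3) by simp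
  moreover have "w \<circ> inv_into UNIV w = id"
    using w(1) bij_is_surj surj_iff by blast
  ultimately show ?thesis
    using i by (simp add: carrier_affine_sym shift_sum_def)
qed

lemma group_affine_sym:
  assumes "n \<ge> 1"
  shows "group (affine_sym n)"
proof (rule groupI)
  show "\<exists>y\<in>carrier (affine_sym n). y \<otimes>\<^bsub>affine_sym n\<^esub> x = \<one>\<^bsub>affine_sym n\<^esub>"
    if "x \<in> carrier (affine_sym n)" for x
    using that inv_in_affine_sym[OF assms that]
    by (intro bexI[of _ "inv_into UNIV x"]) (auto simp: carrier_affine_sym bij_is_inj)
qed (auto simp: comp_in_affine_sym[OF assms] id_in_affine_sym comp_assoc)

lemma m_inv_affine_sym:
  assumes "n \<ge> 1" "w \<in> carrier (affine_sym n)"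
  shows "m_inv (affine_sym n) w = inv_into UNIV w"
proof (rule group.inv_equality[OF group_affine_sym[OF assms(1)]])
  show "inv_into UNIV w \<otimes>\<^bsub>affine_sym n\<^esub> w = \<one>\<^bsub>affine_sym n\<^esub>"
    using assms(2) by (simp add: carrier_affine_sym bij_is_inj)
qed (use assms inv_in_affine_sym in auto)

text \<open>A homomorphism to the integers kills involutions. This covers both the simple
  transpositions and block reversals.\<close>

lemma involution_in_affine_sym:
  assumes "n \<ge> 1" "equivariant n p" "p \<circ> p = id"
  shows "p \<in> carrier (affine_sym n)"
proof -
  have b: "bij p" using assms(3) by (rule o_bij[OF assms(3)])
  have "shift_sum n (p \<circ> p) = 2 * shift_sum n p"
    using shift_sum_comp[OF assms(1,2,2) bij_is_inj[OF b]] by simp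
  then have "shift_sum n p = 0" by (simp add: assms(3)) (simp add: shift_sum_def)
  then show ?thesis using b assms(2) by (simp add: carrier_affine_sym)
qed

section \<open>Simple transpositions\<close>

context
  fixes n :: nat and i :: int
  assumes n: "n \<ge> 2"
begin

lemma transposition_cong_not_succ: "\<not> ([j = i] (mod int n) \<and> [j = i + 1] (mod int n))"
proof
  assume "[j = i] (mod int n) \<and> [j = i + 1] (mod int n)"
  then have "[i + 1 = i] (mod int n)" by (meson cong_sym cong_trans)
  then have "int n dvd 1" by (simp add: cong_iff_dvd_diff)
  then show False using n by simp
qed

lemma affine_transposition_cases:
  obtains "[j = i] (mod int n)" "affine_transposition n i j = j + 1"
  | "[j = i + 1] (mod int n)" "affine_transposition n i j = j - 1"
  | "\<not> [j = i] (mod int n)" "\<not> [j = i + 1] (mod int n)" "affine_transposition n i j = j"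
  by (cases "[j = i] (mod int n)"; cases "[j = i + 1] (mod int n)")
    (auto simp: affine_transposition_def)

lemma affine_transposition_simps:
  "[j = i] (mod int n) \<Longrightarrow> affine_transposition n i j = j + 1"
  "[j = i] (mod int n) \<Longrightarrow> affine_transposition n i (j + 1) = j"
proof -
  assume j: "[j = i] (mod int n)"
  then show "affine_transposition n i j = j + 1"
    by (simp add: affine_transposition_def)
  have "[j + 1 = i + 1] (mod int n)" using j by (simp add: cong_add_rcancel)
  then show "affine_transposition n i (j + 1) = j"
    using transposition_cong_not_succ[of "j + 1"] by (simp add: affine_transposition_def)
qed

lemma affine_transposition_comp_self: "affine_transposition n i \<circ> affine_transposition n i = id"
proof
  fix j
  show "(affine_transposition n i \<circ> affine_transposition n i) j = id j"
  proof (cases rule: affine_transposition_cases[of j])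
    case 1
    then show ?thesis using affine_transposition_simps by simp
  next
    case 2
    then have "[j - 1 = i] (mod int n)"
      by (metis cong_add_rcancel diff_add_cancel)
    then show ?thesis using 2 affine_transposition_simps(1) by simp
  qed simp
qed

lemma equivariant_affine_transposition: "equivariant n (affine_transposition n i)"
proof -
  have "[j + int n = c] (mod int n) \<longleftrightarrow> [j = c] (mod int n)" for j c
    by (simp add: cong_def)
  then show ?thesis by (simp add: equivariant_def affine_transposition_def)
qed

lemma affine_transposition_in_affine_sym: "affine_transposition n i \<in> carrier (affine_sym n)"
  by (rule involution_in_affine_sym)
    (use n equivariant_affine_transposition affine_transposition_comp_self in auto)

text \<open>Each point moves by at most 1, so only neighbours can change their order, and of these
  only the pairs that are swapped.\<close>

lemma affine_transposition_less:
  assumes "p < q" "\<not> ([p = i] (mod int n) \<and> q = p + 1)"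
  shows "affine_transposition n i p < affine_transposition n i q"
proof (rule ccontr)
  let ?s = "affine_transposition n i"
  assume "\<not> ?thesis"
  then have le: "?s q \<le> ?s p" by simp
  have sp: "?s p \<le> p + 1" "?s q \<ge> q - 1"
    by (auto simp: affine_transposition_def)
  have ne: "?s p \<noteq> ?s q"
    using affine_transposition_comp_self assms(1) by (metis comp_apply id_apply less_irrefl)
  have q: "q = p + 1" using le sp ne assms(1) by linarith
  then have "\<not> [p = i] (mod int n)" using assms(2) by simp
  moreover have "\<not> [q = i + 1] (mod int n)"
    using calculation q by (simp add: cong_add_rcancel)
  ultimately show False
    using le q by (auto simp: affine_transposition_def split: if_splits)
qed

end

text \<open>Sets of pairs invariant under the diagonal translation by \<open>n\<close> are counted modulo this
  translation, each orbit being represented by its pair with first entry in \<open>{0..<n}\<close>.\<close>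

definition orbit_reps :: "nat \<Rightarrow> (int \<times> int) set \<Rightarrow> (int \<times> int) set" where
  "orbit_reps n P = {z \<in> P. fst z \<in> {0..<int n}}"

definition diag_invariant :: "nat \<Rightarrow> (int \<times> int) set \<Rightarrow> bool" where
  "diag_invariant n P \<longleftrightarrow> (\<forall>a b k. (a, b) \<in> P \<longrightarrow> (a + k * int n, b + k * int n) \<in> P)"

lemma diag_invariant_iff:
  assumes "diag_invariant n P"
  shows "(a + k * int n, b + k * int n) \<in> P \<longleftrightarrow> (a, b) \<in> P"
proof
  assume "(a + k * int n, b + k * int n) \<in> P"
  then have "(a + k * int n + (- k) * int n, b + k * int n + (- k) * int n) \<in> P"
    using assms unfolding diag_invariant_def by blast
  then show "(a, b) \<in> P" by simp
qed (use assms in \<open>simp add: diag_invariant_def\<close>)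

lemma diag_invariant_normalize:
  assumes "n \<ge> 1" "diag_invariant n P" "(a, b) \<in> P"
  shows "(a mod int n, b - a div int n * int n) \<in> orbit_reps n P"
proof -
  have "(a + - (a div int n) * int n, b + - (a div int n) * int n) \<in> P"
    using assms(2,3) unfolding diag_invariant_def by blast
  moreover have "a + - (a div int n) * int n = a mod int n"
    by (simp add: minus_div_mult_eq_mod[symmetric])
  ultimately show ?thesis using assms(1) by (simp add: orbit_reps_def)
qed

lemma orbit_reps_unique:
  assumes "a \<in> {0..<int n}" "a + k * int n \<in> {0..<int n}"
  shows "k = 0"
proof -
  have "\<bar>k * int n\<bar> < int n" using assms by auto
  then show ?thesis using assms by (auto simp: abs_mult mult_less_cancel_right1)
qed

text \<open>A bijection commuting with the translation descends to orbits; \<open>\<nu>\<close>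
  translates a pair to the representative of its orbit.\<close>

lemma card_orbit_reps_eq:
  assumes n: "n \<ge> 1" and P: "diag_invariant n P" and Q: "diag_invariant n Q"
    and bij: "bij_betw \<phi> P Q"
    and shift: "\<And>a b k. \<phi> (a + k * int n, b + k * int n) =
      (fst (\<phi> (a, b)) + k * int n, snd (\<phi> (a, b)) + k * int n)"
  shows "card (orbit_reps n P) = card (orbit_reps n Q)"
proof -
  define \<nu> where "\<nu> z = (fst z mod int n, snd z - fst z div int n * int n)" for z :: "int \<times> int"
  have \<nu>: "\<nu> z \<in> orbit_reps n R" if "diag_invariant n R" "z \<in> R" for z R
    using diag_invariant_normalize[OF n that(1), of "fst z" "snd z"] that(2) by (simp add: \<nu>_def)
  have \<nu>_shift: "z = (fst (\<nu> z) + fst z div int n * int n, snd (\<nu> z) + fst z div int n * int n)" for z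
    by (simp add: \<nu>_def)
  have "bij_betw (\<nu> \<circ> \<phi>) (orbit_reps n P) (orbit_reps n Q)"
    unfolding bij_betw_def
  proof
    show "inj_on (\<nu> \<circ> \<phi>) (orbit_reps n P)"
    proof (rule inj_onI)
      fix z z' assume z: "z \<in> orbit_reps n P" "z' \<in> orbit_reps n P"
        and eq: "(\<nu> \<circ> \<phi>) z = (\<nu> \<circ> \<phi>) z'"
      define k where "k = fst (\<phi> z') div int n - fst (\<phi> z) div int n"
      \<comment> \<open>Equal representatives mean that the images, hence \<open>z\<close> and
        \<open>z'\<close>, differ by a translation; two representatives in one orbit
        coincide.\<close>
      have "\<phi> z' = (fst (\<phi> z) + k * int n, snd (\<phi> z) + k * int n)"
        using \<nu>_shift[of "\<phi> z"] \<nu>_shift[of "\<phi> z'"] eq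
        by (simp add: k_def prod_eq_iff algebra_simps)
      also have "\<dots> = \<phi> (fst z + k * int n, snd z + k * int n)"
        by (simp add: shift)
      finally have "\<phi> z' = \<phi> (fst z + k * int n, snd z + k * int n)" .
      moreover have "(fst z + k * int n, snd z + k * int n) \<in> P"
        using P z(1) by (simp add: diag_invariant_def orbit_reps_def)
      ultimately have z': "z' = (fst z + k * int n, snd z + k * int n)"
        using bij z by (auto simp: bij_betw_def inj_on_def orbit_reps_def)
      then have "k = 0"
        using z orbit_reps_unique[of "fst z" n k] by (auto simp: orbit_reps_def)
      then show "z = z'" using z' by simp
    qed
    show "(\<nu> \<circ> \<phi>) ` orbit_reps n P = orbit_reps n Q"
    proof
      show "(\<nu> \<circ> \<phi>) ` orbit_reps n P \<subseteq> orbit_reps n Q"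
      proof (rule image_subsetI)
        fix z assume "z \<in> orbit_reps n P"
        then have "\<phi> z \<in> Q" using bij_betwE[OF bij] by (simp add: orbit_reps_def)
        then show "(\<nu> \<circ> \<phi>) z \<in> orbit_reps n Q" using \<nu>[OF Q] by simp
      qed
      show "orbit_reps n Q \<subseteq> (\<nu> \<circ> \<phi>) ` orbit_reps n P"
      proof
        fix y assume y: "y \<in> orbit_reps n Q"
        then obtain z where z: "z \<in> P" "\<phi> z = y"
          using bij by (auto simp: orbit_reps_def bij_betw_def)
        define k where "k = fst z div int n"
        have "\<phi> z = (fst (\<phi> (\<nu> z)) + k * int n, snd (\<phi> (\<nu> z)) + k * int n)"
          using shift[of "fst (\<nu> z)" k "snd (\<nu> z)"] \<nu>_shift[of z] by (simp add: k_def)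
        then have y_eq: "fst y = fst (\<phi> (\<nu> z)) + k * int n" "snd y = snd (\<phi> (\<nu> z)) + k * int n"
          using z by auto
        have "fst y \<in> {0..<int n}" using y by (simp add: orbit_reps_def)
        then have "fst (\<phi> (\<nu> z)) mod int n = fst y" "fst (\<phi> (\<nu> z)) div int n = - k"
        proof -
          have f: "fst (\<phi> (\<nu> z)) = fst y + (- k) * int n" using y_eq by simp
          show "fst (\<phi> (\<nu> z)) mod int n = fst y"
            unfolding f mod_mult_self1 using \<open>fst y \<in> {0..<int n}\<close> by simp
          show "fst (\<phi> (\<nu> z)) div int n = - k"
            unfolding f using \<open>fst y \<in> {0..<int n}\<close> n by (subst div_mult_self1) simp_all
        qed
        then have "(\<nu> \<circ> \<phi>) (\<nu> z) = y"
          using y_eq by (simp add: \<nu>_def[of "\<phi> (\<nu> z)"] prod_eq_iff)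
        then show "y \<in> (\<nu> \<circ> \<phi>) ` orbit_reps n P"
          using \<nu>[OF P z(1)] by blast
      qed
    qed
  qed
  then show ?thesis by (rule bij_betw_same_card)
qed

text \<open>\<open>min\<close> and \<open>max\<close> treat a pair as unordered, so relabelling by
  \<open>f\<close> is a bijection even where \<open>f\<close> reverses the order. All comparisons of
  inversion numbers below are instances of this.\<close>

lemma card_orbit_reps_relabel:
  assumes n: "n \<ge> 1" and f: "bij f" "equivariant n f"
    and P: "diag_invariant n P" "P \<subseteq> {(a, b). a < b}"
    and Q: "diag_invariant n Q" "Q \<subseteq> {(a, b). a < b}"
    and PQ: "\<And>p q. p < q \<Longrightarrow> (p, q) \<in> P \<longleftrightarrow> (min (f p) (f q), max (f p) (f q)) \<in> Q"
  shows "card (orbit_reps n P) = card (orbit_reps n Q)"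
proof (rule card_orbit_reps_eq[OF n P(1) Q(1)])
  define sp where "sp g = (\<lambda>(a::int, b). (min (g a) (g b), max (g a) (g b)))" for g :: "int \<Rightarrow> int"
  have sp: "sp (inv_into UNIV f) (sp f (a, b)) = (a, b)" "sp f (sp (inv_into UNIV f) (a, b)) = (a, b)"
    if "a < b" for a b
    using that f(1)
    by (auto simp: sp_def min_def max_def bij_is_inj bij_is_surj surj_f_inv_f)
  show "bij_betw (sp f) P Q"
  proof (rule bij_betw_byWitness[where f' = "sp (inv_into UNIV f)"])
    show "\<forall>z\<in>P. sp (inv_into UNIV f) (sp f z) = z" using P(2) sp by auto
    show "\<forall>z\<in>Q. sp f (sp (inv_into UNIV f) z) = z" using Q(2) sp by auto
    show "sp f ` P \<subseteq> Q" using P(2) PQ by (auto simp: sp_def)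
    show "sp (inv_into UNIV f) ` Q \<subseteq> P"
    proof (rule image_subsetI)
      fix z assume z: "z \<in> Q"
      obtain a b where ab: "z = (a, b)" "a < b" using z Q(2) by auto
      obtain p q where pq: "sp (inv_into UNIV f) z = (p, q)" by fastforce
      have "inv_into UNIV f a \<noteq> inv_into UNIV f b"
        using f(1) ab(2) by (metis bij_is_surj less_irrefl surj_f_inv_f)
      then have "p < q"
        using pq ab by (auto simp: sp_def min_def max_def split: if_splits)
      moreover have "sp f (p, q) = z"
        using pq sp(2)[OF ab(2)] ab(1) by simp
      ultimately show "sp (inv_into UNIV f) z \<in> P"
        using PQ[of p q] z pq by (simp add: sp_def)
    qed
  qed
  show "sp f (a + k * int n, b + k * int n) =
      (fst (sp f (a, b)) + k * int n, snd (sp f (a, b)) + k * int n)" for a b k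
    using equivariant_add_mult[OF f(2)] by (simp add: sp_def min_def max_def)
qed

section \<open>Inversions modulo translation\<close>

definition inversions :: "(int \<Rightarrow> int) \<Rightarrow> (int \<times> int) set" where
  "inversions w = {(p, q). p < q \<and> w q < w p}"

definition inversion_number :: "nat \<Rightarrow> (int \<Rightarrow> int) \<Rightarrow> nat" where
  "inversion_number n w = card (orbit_reps n (inversions w))"

lemma inversion_number_id: "inversion_number n id = 0"
proof -
  have "inversions id = {}" by (auto simp: inversions_def)
  then show ?thesis by (simp add: inversion_number_def orbit_reps_def)
qed

lemma diag_invariant_inversions: "equivariant n w \<Longrightarrow> diag_invariant n (inversions w)"
  by (simp add: diag_invariant_def inversions_def equivariant_add_mult)

text \<open>Displacements are periodic, hence bounded by some \<open>C\<close>, and an inverted pair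
  is then less than \<open>2 * C\<close> apart.\<close>

lemma finite_orbit_reps_inversions:
  assumes "n \<ge> 1" "equivariant n w"
  shows "finite (orbit_reps n (inversions w))"
proof -
  define d where "d i = w i - i" for i
  define C where "C = Max ((\<lambda>i. \<bar>d i\<bar>) ` {0..<int n})"
  have per: "periodic n d"
    using assms(2) by (simp add: periodic_def equivariant_def d_def)
  have "\<bar>d i\<bar> \<le> C" for i
  proof -
    have "\<bar>d (i mod int n)\<bar> \<le> C"
      unfolding C_def using assms(1) by (intro Max_ge) auto
    then show ?thesis by (simp add: periodic_mod[OF per])
  qed
  then have C: "\<bar>w i - i\<bar> \<le> C" for i by (simp add: d_def)
  have "orbit_reps n (inversions w) \<subseteq> {0..<int n} \<times> {0..int n + 2 * C}"
  proof
    fix z assume "z \<in> orbit_reps n (inversions w)"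
    then have "fst z \<in> {0..<int n}" "fst z < snd z" "w (snd z) < w (fst z)"
      by (auto simp: orbit_reps_def inversions_def)
    then show "z \<in> {0..<int n} \<times> {0..int n + 2 * C}"
      using C[of "fst z"] C[of "snd z"] by (auto simp: mem_Times_iff)
  qed
  then show ?thesis by (rule finite_subset) auto
qed

lemma inversion_number_inv:
  assumes "n \<ge> 1" "w \<in> carrier (affine_sym n)"
  shows "inversion_number n (inv_into UNIV w) = inversion_number n w"
  unfolding inversion_number_def
proof (rule card_orbit_reps_relabel[symmetric])
  have w: "bij w" "equivariant n w" using assms(2) by (auto simp: carrier_affine_sym)
  show "bij w" "equivariant n w" by (fact w)+
  show "diag_invariant n (inversions w)" "diag_invariant n (inversions (inv_into UNIV w))"
    using w by (simp_all add: diag_invariant_inversions equivariant_inv)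
  show "(p, q) \<in> inversions w \<longleftrightarrow>
    (min (w p) (w q), max (w p) (w q)) \<in> inversions (inv_into UNIV w)" if "p < q" for p q
  proof -
    have "w p \<noteq> w q" using w(1) that by (metis bij_is_inj inj_eq less_irrefl)
    then show ?thesis
      using that w(1) by (auto simp: inversions_def min_def max_def bij_is_inj)
  qed
qed (use assms in \<open>auto simp: inversions_def\<close>)

text \<open>Relabelling positions by the transposition matches the inversions of the product with
  those of \<open>w\<close>, except for the translates \<open>C\<close> of the pair
  \<open>(i, i + 1)\<close>.\<close>

lemma inversion_number_comp_transposition:
  assumes n: "n \<ge> 2" and w: "w \<in> carrier (affine_sym n)" and i: "i \<in> descents w"
  shows "inversion_number n w = Suc (inversion_number n (w \<circ> affine_transposition n i))"
proof -
  define s where "s = affine_transposition n i"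
  define C where "C = {(p, q). [p = i] (mod int n) \<and> q = p + 1}"
  define Q where "Q = inversions w - C"
  have n1: "n \<ge> 1" using n by simp
  have w': "bij w" "equivariant n w" using w by (auto simp: carrier_affine_sym)
  have s: "s \<in> carrier (affine_sym n)" "equivariant n s" "bij s"
    using affine_transposition_in_affine_sym[OF n, of i] by (auto simp: s_def carrier_affine_sym)
  have ss: "s (s j) = j" for j
    using affine_transposition_comp_self[OF n, of i] unfolding s_def by (metis comp_apply id_apply)
  have desc: "w (p + 1) < w p" if "[p = i] (mod int n)" for p
  proof -
    have "p mod int n = i mod int n" using that by (simp add: cong_def)
    then have "p \<in> descents w"
      using i periodic_mod[OF equivariant_descents(1)[OF w'(2) n1]] by metis
    then show ?thesis by (simp add: descents_def)
  qed
  have "(a + k * int n, b + k * int n) \<in> C \<longleftrightarrow> (a, b) \<in> C" for a b k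
    by (simp add: C_def cong_def)
  then have invQ: "diag_invariant n Q"
    using diag_invariant_inversions[OF w'(2)] by (simp add: diag_invariant_def Q_def)
  have "inversion_number n (w \<circ> s) = card (orbit_reps n Q)"
    unfolding inversion_number_def
  proof (rule card_orbit_reps_relabel[OF n1 s(3,2)])
    show "diag_invariant n (inversions (w \<circ> s))"
      by (intro diag_invariant_inversions equivariant_comp w' s)
    show "(p, q) \<in> inversions (w \<circ> s) \<longleftrightarrow> (min (s p) (s q), max (s p) (s q)) \<in> Q" if "p < q" for p q
    proof (cases "(p, q) \<in> C")
      case True
      then have "s p = p + 1" "s q = p" "q = p + 1" "w (p + 1) < w p"
        using affine_transposition_simps[OF n, of p i] desc[of p] by (auto simp: C_def s_def)
      then show ?thesis using True by (auto simp: inversions_def Q_def C_def)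
    next
      case False
      then have less: "s p < s q"
        unfolding s_def C_def using that by (intro affine_transposition_less[OF n]) auto
      moreover have "(s p, s q) \<notin> C"
      proof
        assume "(s p, s q) \<in> C"
        then have "s (s p) = s p + 1" "s (s q) = s p"
          using affine_transposition_simps[OF n, of "s p" i] by (auto simp: C_def s_def)
        then show False using that by (simp add: ss)
      qed
      ultimately show ?thesis using that by (auto simp: inversions_def Q_def)
    qed
  qed (use invQ in \<open>auto simp: Q_def inversions_def\<close>)
  \<comment> \<open>\<open>C\<close> is a single orbit and so has one representative, which accounts
    for the \<open>Suc\<close>.\<close>
  moreover have "orbit_reps n (inversions w) = insert (i mod int n, i mod int n + 1) (orbit_reps n Q)"
    using n desc by (auto simp: orbit_reps_def Q_def C_def inversions_def cong_def)
  moreover have "(i mod int n, i mod int n + 1) \<notin> orbit_reps n Q"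
    by (simp add: orbit_reps_def Q_def C_def cong_def)
  moreover have "finite (orbit_reps n Q)"
    by (rule finite_subset[OF _ finite_orbit_reps_inversions[OF n1 w'(2)]])
      (auto simp: orbit_reps_def Q_def)
  ultimately show ?thesis by (simp add: inversion_number_def s_def)
qed

text \<open>Without descents an injective \<open>w\<close> increases strictly, so
  \<open>w i - i\<close> is monotone. Being periodic it is constant, and the sum condition makes the
  constant 0.\<close>

lemma no_descents_eq_id:
  assumes n: "n \<ge> 1" and w: "w \<in> carrier (affine_sym n)" and desc: "descents w = {}"
  shows "w = id"
proof -
  have w': "bij w" "equivariant n w" "shift_sum n w = 0"
    using w by (auto simp: carrier_affine_sym)
  define d where "d i = w i - i" for i
  have per: "periodic n d"
    using w'(2) by (simp add: periodic_def equivariant_def d_def)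
  have step: "d i \<le> d (i + 1)" for i
  proof -
    have "w i \<noteq> w (i + 1)" using w'(1) by (simp add: bij_is_inj inj_eq)
    moreover have "i \<notin> descents w" using desc by simp
    ultimately show ?thesis by (simp add: descents_def d_def)
  qed
  have mono: "d i \<le> d (i + int k)" for i k
  proof (induction k)
    case (Suc k)
    then show ?case using step[of "i + int k"] by (simp add: algebra_simps)
  qed simp
  have const: "d i = d 0" for i
  proof (rule antisym)
    \<comment> \<open>Monotonicity is applied up to a multiple of \<open>n\<close> not below
      \<open>i\<close>, where periodicity returns the value \<open>d 0\<close>.\<close>
    have "d i \<le> d (i + int (nat (- i + \<bar>i\<bar> * int n)))" by (rule mono)
    moreover have "- i + \<bar>i\<bar> * int n \<ge> 0"
      using n mult_left_mono[of 1 "int n" "\<bar>i\<bar>"] by simp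
    ultimately show "d i \<le> d 0"
      using periodic_add_mult[OF per, of 0 "\<bar>i\<bar>"] by simp
    have "d (- \<bar>i\<bar> * int n) \<le> d (- \<bar>i\<bar> * int n + int (nat (i + \<bar>i\<bar> * int n)))" by (rule mono)
    moreover have "i + \<bar>i\<bar> * int n \<ge> 0"
      using n mult_left_mono[of 1 "int n" "\<bar>i\<bar>"] by simp
    ultimately show "d 0 \<le> d i"
      using periodic_add_mult[OF per, of 0 "- \<bar>i\<bar>"] by simp
  qed
  have "(\<Sum>i=1..int n. d i) = int n * d 0"
    by (subst const) simp
  then have "int n * d 0 = 0" using w'(3) by (simp add: shift_sum_def d_def)
  then have "d i = 0" for i using n const[of i] by simp
  then show ?thesis by (auto simp: d_def)
qed

lemma descents_one: "equivariant 1 w \<Longrightarrow> descents w = {}"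
  by (auto simp: equivariant_def descents_def)

lemma ex_descent:
  assumes n: "n \<ge> 1" and w: "w \<in> carrier (affine_sym n)" and "w \<noteq> id"
  shows "n \<ge> 2 \<and> (\<exists>i \<in> {1..int n}. i \<in> descents w)"
proof
  have w': "equivariant n w" using w by (simp add: carrier_affine_sym)
  obtain i where i: "i \<in> descents w"
    using no_descents_eq_id[OF n w] assms(3) by blast
  show "n \<ge> 2" using descents_one[of w] w' i n by (cases "n = 1") auto
  show "\<exists>i \<in> {1..int n}. i \<in> descents w"
  proof
    show "(i - 1) mod int n + 1 \<in> {1..int n}" using n by (simp add: add1_zle_eq)
    have "(i - 1) mod int n + 1 = i + - ((i - 1) div int n) * int n"
      by (simp add: minus_div_mult_eq_mod[symmetric])
    then show "(i - 1) mod int n + 1 \<in> descents w"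
      using i periodic_add_mult[OF equivariant_descents(1)[OF w' n]] by metis
  qed
qed

section \<open>Reduced words, length and weak order\<close>

lemma foldr_comp_append: "foldr (\<circ>) (us @ [s]) id = foldr (\<circ>) us id \<circ> s"
  by (induction us) (auto simp: comp_assoc)

text \<open>Appending a generator changes the inversion number by exactly one, in one direction or
  the other.\<close>

lemma inversion_number_word_le:
  assumes n: "n \<ge> 1" and us: "set us \<subseteq> affine_simple n"
  shows "foldr (\<circ>) us id \<in> carrier (affine_sym n) \<and>
    inversion_number n (foldr (\<circ>) us id) \<le> length us"
  using us
proof (induction us rule: rev_induct)
  case Nil
  have "foldr (\<circ>) [] id = id" by (simp only: foldr.simps id_apply)
  then show ?case by (metis id_in_affine_sym inversion_number_id le0)
next
  case (snoc s us)
  define w where "w = foldr (\<circ>) us id"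
  have "set us \<subseteq> affine_simple n" using snoc.prems by simp
  from snoc.IH[OF this] have w: "w \<in> carrier (affine_sym n)" "inversion_number n w \<le> length us"
    unfolding w_def by blast+
  obtain i where n2: "n \<ge> 2" and s: "s = affine_transposition n i"
    using snoc.prems by (auto simp: affine_simple_def split: if_splits)
  have ws: "w \<circ> s \<in> carrier (affine_sym n)"
    unfolding s by (rule comp_in_affine_sym[OF n w(1) affine_transposition_in_affine_sym[OF n2]])
  have "inversion_number n (w \<circ> s) \<le> Suc (inversion_number n w)"
  proof (cases "i \<in> descents w")
    case True
    then show ?thesis using inversion_number_comp_transposition[OF n2 w(1)] by (simp add: s)
  next
    case False
    have "w i \<noteq> w (i + 1)"
      using w(1) by (simp add: carrier_affine_sym bij_is_inj inj_eq)
    then have "i \<in> descents (w \<circ> s)"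
      using False affine_transposition_simps[OF n2, of i i] by (simp add: s descents_def)
    from inversion_number_comp_transposition[OF n2 ws this]
    show ?thesis
      using affine_transposition_comp_self[OF n2, of i] by (simp add: s comp_assoc)
  qed
  then show ?case
    using w(2) ws unfolding foldr_comp_append w_def[symmetric] length_append_singleton
    by (metis Suc_le_mono le_trans)
qed

text \<open>Sorting: as long as \<open>w\<close> is not the identity it has a descent, and
  multiplying by the transposition there removes one inversion.\<close>

lemma ex_word:
  assumes n: "n \<ge> 1" and w: "w \<in> carrier (affine_sym n)"
  shows "\<exists>us. length us = inversion_number n w \<and> set us \<subseteq> affine_simple n \<and> foldr (\<circ>) us id = w"
  using w
proof (induction "inversion_number n w" arbitrary: w rule: less_induct)
  case less
  show ?case
  proof (cases "w = id")
    case True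
    have "foldr (\<circ>) [] id = id" by (simp only: foldr.simps id_apply)
    then show ?thesis
      unfolding True inversion_number_id by (intro exI[of _ "[]"]) simp
  next
    case False
    then obtain i where n2: "n \<ge> 2" and i: "i \<in> {1..int n}" "i \<in> descents w"
      using ex_descent[OF n less.prems] by blast
    define s where "s = affine_transposition n i"
    have inv: "inversion_number n w = Suc (inversion_number n (w \<circ> s))"
      unfolding s_def by (rule inversion_number_comp_transposition[OF n2 less.prems i(2)])
    have "w \<circ> s \<in> carrier (affine_sym n)"
      unfolding s_def by (rule comp_in_affine_sym[OF n less.prems affine_transposition_in_affine_sym[OF n2]])
    then obtain us where us: "length us = inversion_number n (w \<circ> s)" "set us \<subseteq> affine_simple n"
      "foldr (\<circ>) us id = w \<circ> s"
      using less.hyps[of "w \<circ> s"] inv by auto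
    have "foldr (\<circ>) (us @ [s]) id = w"
      unfolding foldr_comp_append us(3) using affine_transposition_comp_self[OF n2, of i]
      by (simp add: s_def comp_assoc)
    moreover have "s \<in> affine_simple n" using n2 i by (simp add: s_def affine_simple_def)
    ultimately show ?thesis
      using us inv by (intro exI[of _ "us @ [s]"]) (simp del: foldr_append)
  qed
qed

lemma coxeter_length_affine:
  assumes n: "n \<ge> 1" and w: "w \<in> carrier (affine_sym n)"
  shows "coxeter_length (affine_sym n) (affine_simple n) w = inversion_number n w"
proof -
  have mult: "(\<lambda>x y. x \<otimes>\<^bsub>affine_sym n\<^esub> y) = (\<circ>)" by (simp add: fun_eq_iff)
  show ?thesis
    unfolding coxeter_length_def one_affine_sym mult
  proof (rule Least_equality)
    show "\<exists>us. length us = inversion_number n w \<and> set us \<subseteq> affine_simple n \<and> foldr (\<circ>) us id = w"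
      by (rule ex_word[OF n w])
    show "inversion_number n w \<le> k"
      if "\<exists>us. length us = k \<and> set us \<subseteq> affine_simple n \<and> foldr (\<circ>) us id = w" for k
      using that inversion_number_word_le[OF n] by blast
  qed
qed

text \<open>A pair of positions is inverted by \<open>x\<^sup>-\<^sup>1 y\<close> iff exactly one of
  \<open>x\<^sup>-\<^sup>1\<close> and \<open>y\<^sup>-\<^sup>1\<close> inverts the corresponding
  values. The length of \<open>x\<^sup>-\<^sup>1 y\<close> thus counts the symmetric difference of
  \<open>X\<close> and \<open>Y\<close>, and it equals the difference of the lengths iff
  \<open>X - Y\<close> contributes nothing.\<close>

lemma right_weak_order_affine_iff:
  assumes n: "n \<ge> 1" and x: "x \<in> carrier (affine_sym n)" and y: "y \<in> carrier (affine_sym n)"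
  shows "x \<sqsubseteq>\<^bsub>right_weak_order (affine_sym n) (affine_simple n)\<^esub> y \<longleftrightarrow>
    inversions (inv_into UNIV x) \<subseteq> inversions (inv_into UNIV y)"
proof -
  define X where "X = inversions (inv_into UNIV x)"
  define Y where "Y = inversions (inv_into UNIV y)"
  have x': "bij x" "equivariant n x" and y': "bij y" "equivariant n y"
    using x y by (auto simp: carrier_affine_sym)
  have ix: "inv_into UNIV x \<in> carrier (affine_sym n)" and iy: "inv_into UNIV y \<in> carrier (affine_sym n)"
    using inv_in_affine_sym[OF n] x y by auto
  have eix: "equivariant n (inv_into UNIV x)" and eiy: "equivariant n (inv_into UNIV y)"
    using ix iy by (auto simp: carrier_affine_sym)
  have invX: "diag_invariant n X" and invY: "diag_invariant n Y"
    using eix eiy by (auto simp: X_def Y_def diag_invariant_inversions)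
  have invD: "diag_invariant n ((X - Y) \<union> (Y - X))"
    by (simp add: diag_invariant_def diag_invariant_iff[OF invX] diag_invariant_iff[OF invY])
  have fin: "finite (orbit_reps n X)" "finite (orbit_reps n Y)"
    unfolding X_def Y_def by (intro finite_orbit_reps_inversions n eix eiy)+
  have "inversion_number n (inv_into UNIV x \<circ> y) = card (orbit_reps n ((X - Y) \<union> (Y - X)))"
    unfolding inversion_number_def
  proof (rule card_orbit_reps_relabel[OF n y'])
    show "diag_invariant n (inversions (inv_into UNIV x \<circ> y))"
      by (intro diag_invariant_inversions equivariant_comp eix y')
    show "(p, q) \<in> inversions (inv_into UNIV x \<circ> y) \<longleftrightarrow>
        (min (y p) (y q), max (y p) (y q)) \<in> (X - Y) \<union> (Y - X)" if "p < q" for p q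
    proof -
      have "y p \<noteq> y q" using y'(1) that by (metis bij_is_inj inj_eq less_irrefl)
      moreover from this have "inv_into UNIV x (y p) \<noteq> inv_into UNIV x (y q)"
        using x'(1) by (metis bij_is_surj surj_f_inv_f)
      ultimately show ?thesis
        using that y'(1) by (auto simp: inversions_def min_def max_def X_def Y_def bij_is_inj)
    qed
    show "diag_invariant n ((X - Y) \<union> (Y - X))" by (fact invD)
  qed (auto simp: inversions_def X_def Y_def)
  also have "orbit_reps n ((X - Y) \<union> (Y - X)) =
      (orbit_reps n X - orbit_reps n Y) \<union> (orbit_reps n Y - orbit_reps n X)"
    by (auto simp: orbit_reps_def)
  also have "card \<dots> = card (orbit_reps n X - orbit_reps n Y) + card (orbit_reps n Y - orbit_reps n X)"
    using fin by (intro card_Un_disjoint) auto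
  finally have len: "inversion_number n (inv_into UNIV x \<circ> y) =
      card (orbit_reps n X - orbit_reps n Y) + card (orbit_reps n Y - orbit_reps n X)" .
  have lx: "int (inversion_number n x) =
      int (card (orbit_reps n X - orbit_reps n Y)) + int (card (orbit_reps n X \<inter> orbit_reps n Y))"
    using card_Int_Diff[OF fin(1), of "orbit_reps n Y"] inversion_number_inv[OF n x]
    by (simp add: inversion_number_def X_def)
  have ly: "int (inversion_number n y) =
      int (card (orbit_reps n Y - orbit_reps n X)) + int (card (orbit_reps n X \<inter> orbit_reps n Y))"
    using card_Int_Diff[OF fin(2), of "orbit_reps n X"] inversion_number_inv[OF n y]
    by (simp add: inversion_number_def Y_def Int_commute)
  have "x \<sqsubseteq>\<^bsub>right_weak_order (affine_sym n) (affine_simple n)\<^esub> y \<longleftrightarrow>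
      int (inversion_number n (inv_into UNIV x \<circ> y)) = int (inversion_number n y) - int (inversion_number n x)"
    using comp_in_affine_sym[OF n ix y]
    by (simp add: right_weak_order_def m_inv_affine_sym[OF n x] coxeter_length_affine[OF n] x y)
  also have "\<dots> \<longleftrightarrow> orbit_reps n X - orbit_reps n Y = {}"
    using fin by (simp add: len lx ly)
  also have "\<dots> \<longleftrightarrow> X \<subseteq> Y"
  proof
    assume reps: "orbit_reps n X - orbit_reps n Y = {}"
    show "X \<subseteq> Y"
    proof clarify
      fix a b assume "(a, b) \<in> X"
      then have "(a mod int n, b - a div int n * int n) \<in> orbit_reps n Y"
        using diag_invariant_normalize[OF n invX] reps by blast
      then have "(a + (- (a div int n)) * int n, b + (- (a div int n)) * int n) \<in> Y"
        by (simp add: orbit_reps_def minus_div_mult_eq_mod[symmetric])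
      then show "(a, b) \<in> Y" by (simp only: diag_invariant_iff[OF invY])
    qed
  qed (auto simp: orbit_reps_def)
  finally show ?thesis by (simp add: X_def Y_def)
qed

text \<open>A descent of \<open>x\<^sup>-\<^sup>1 y\<close> would exhibit a pair of values in
  exactly one of the two inversion sets, and an element without descents is the identity.\<close>

lemma right_weak_order_affine_antisym:
  assumes n: "n \<ge> 1" and x: "x \<in> carrier (affine_sym n)" and y: "y \<in> carrier (affine_sym n)"
    and eq: "inversions (inv_into UNIV x) = inversions (inv_into UNIV y)"
  shows "x = y"
proof -
  let ?f = "inv_into UNIV x \<circ> y"
  have x': "bij x" and y': "bij y" using x y by (auto simp: carrier_affine_sym)
  have "descents ?f = {}"
  proof (rule ccontr)
    assume "descents ?f \<noteq> {}"
    then obtain p where p: "inv_into UNIV x (y (p + 1)) < inv_into UNIV x (y p)"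
      by (auto simp: descents_def)
    then have "y p \<noteq> y (p + 1)" by auto
    then consider "y p < y (p + 1)" | "y (p + 1) < y p" by linarith
    then show False
    proof cases
      case 1
      then have "(y p, y (p + 1)) \<in> inversions (inv_into UNIV y)"
        using p eq by (auto simp: inversions_def)
      then show False using y' by (simp add: inversions_def bij_is_inj)
    next
      case 2
      then have "(y (p + 1), y p) \<in> inversions (inv_into UNIV x)"
        using y' unfolding eq by (simp add: inversions_def bij_is_inj)
      then show False using p by (simp add: inversions_def)
    qed
  qed
  then have "?f = id"
    by (intro no_descents_eq_id[OF n] comp_in_affine_sym[OF n] inv_in_affine_sym[OF n] x y)
  then show ?thesis
    using x' by (metis bij_is_surj comp_apply ext id_apply surj_f_inv_f)
qed

lemma right_descents_affine:
  assumes n: "n \<ge> 1" and w: "w \<in> carrier (affine_sym n)"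
  shows "right_descents (affine_sym n) (affine_simple n) w =
    affine_transposition n ` ({1..int n} \<inter> descents w)"
proof (cases "n = 1")
  case True
  then show ?thesis
    using w descents_one[of w] by (simp add: right_descents_def affine_simple_def carrier_affine_sym)
next
  case False
  then have n2: "n \<ge> 2" using n by simp
  have "coxeter_length (affine_sym n) (affine_simple n) (w \<circ> affine_transposition n i) <
      coxeter_length (affine_sym n) (affine_simple n) w \<longleftrightarrow> i \<in> descents w" for i
  proof -
    have s: "affine_transposition n i \<in> carrier (affine_sym n)"
      by (rule affine_transposition_in_affine_sym[OF n2])
    have ws: "w \<circ> affine_transposition n i \<in> carrier (affine_sym n)"
      by (rule comp_in_affine_sym[OF n w s])
    show ?thesis
    proof (cases "i \<in> descents w")
      case True
      then show ?thesis
        using inversion_number_comp_transposition[OF n2 w True]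
        by (simp add: coxeter_length_affine[OF n] w ws)
    next
      case False
      have "w i \<noteq> w (i + 1)"
        using w by (simp add: carrier_affine_sym bij_is_inj inj_eq)
      then have "i \<in> descents (w \<circ> affine_transposition n i)"
        using False affine_transposition_simps[OF n2, of i i] by (simp add: descents_def)
      from inversion_number_comp_transposition[OF n2 ws this]
      have "inversion_number n (w \<circ> affine_transposition n i) = Suc (inversion_number n w)"
        using affine_transposition_comp_self[OF n2, of i] by (simp add: comp_assoc)
      then show ?thesis using False by (simp add: coxeter_length_affine[OF n] w ws)
    qed
  qed
  then show ?thesis
    using n2 by (auto simp: right_descents_def affine_simple_def)
qed

section \<open>\<open>Pop\<close> as block reversal\<close>

lemma rev_runs_less_iff:
  assumes gap: "gappy D" and pq: "p < q"
  shows "rev_runs D p < rev_runs D q \<longleftrightarrow> \<not> {p..<q} \<subseteq> D"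
proof -
  obtain a b where ab: "run D a b" "p \<in> {a..b}" using run_exists[OF gap] .
  obtain c d where cd: "run D c d" "q \<in> {c..d}" using run_exists[OF gap] .
  have r: "rev_runs D p = a + b - p" "rev_runs D q = c + d - q"
    using rev_runs_eq ab cd by auto
  show ?thesis
  \<comment> \<open>The case distinction is whether \<open>q\<close> lies in the block of
    \<open>p\<close>: reversal flips the order within a block and keeps the order of different
    blocks.\<close>
  proof (cases "q \<le> b")
    case True
    then have "c = a \<and> d = b" using run_unique[OF ab(1) cd(1), of q] ab(2) cd(2) pq by auto
    moreover have "{p..<q} \<subseteq> D" using True ab runD(4)[OF ab(1)] by auto
    ultimately show ?thesis using r pq by auto
  next
    case False
    then have "b \<in> {p..<q}" using ab(2) by auto
    then have "\<not> {p..<q} \<subseteq> D" using runD(3)[OF ab(1)] by blast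
    moreover have "b < c"
    proof (rule ccontr)
      assume "\<not> b < c"
      then have "b \<in> D" using False cd by (intro runD(4)[OF cd(1)]) auto
      then show False using runD(3)[OF ab(1)] by simp
    qed
    ultimately show ?thesis using r ab cd by auto
  qed
qed

lemma decreasing_on_interval:
  fixes f :: "int \<Rightarrow> int"
  assumes "p < q" "\<And>j. j \<in> {p..<q} \<Longrightarrow> f (j + 1) < f j"
  shows "f q < f p"
  using assms
proof (induction q rule: int_gr_induct)
  case base
  then show ?case by simp
next
  case (step q)
  have "f (q + 1) < f q" using step by simp
  also have "f q < f p" using step by simp
  finally show ?case .
qed

text \<open>\<open>w\<close> and \<open>pop_runs w\<close> differ by the block reversal of the
  descents of \<open>w\<close>, which is an involution in the group. The direction from
  \<open>pop_runs w\<close> to \<open>w\<close> later supplies the sum condition for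
  preimages.\<close>

lemma pop_runs_in_affine_sym:
  assumes n: "n \<ge> 1" and w: "equivariant n w"
  shows "pop_runs w \<in> carrier (affine_sym n) \<longleftrightarrow> w \<in> carrier (affine_sym n)"
proof -
  have gap: "gappy (descents w)" using equivariant_descents(2)[OF w n] .
  have r: "rev_runs (descents w) \<in> carrier (affine_sym n)"
    by (intro involution_in_affine_sym n equivariant_rev_runs equivariant_descents[OF w n]
        rev_runs_comp_rev_runs)
  show ?thesis
    using comp_in_affine_sym[OF n _ r] pop_runs_comp_rev_runs[OF gap]
    by (metis pop_runs_def)
qed

text \<open>With \<open>r\<close> the block reversal, the inverse of \<open>u\<close> is
  \<open>r \<circ> w'\<close>, whose inversions are those of \<open>w'\<close> with the two
  positions in different blocks. No single transposition at a descent destroys such an inversion, so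
  \<open>u\<close> is a lower bound. Conversely, below all the products no two adjacent values of a
  block may be inverted, and by transitivity along the block no two values of it at all.\<close>

theorem Pop_affine_sym:
  assumes n: "n \<ge> 1" and w: "w \<in> carrier (affine_sym n)"
  shows "Pop (affine_sym n) (affine_simple n) w = pop_runs w"
proof -
  let ?L = "right_weak_order (affine_sym n) (affine_simple n)"
  define D where "D = descents w"
  define r where "r = rev_runs D"
  define u where "u = pop_runs w"
  define w' where "w' = inv_into UNIV w"
  define A where "A = {w \<circ> affine_transposition n i | i. i \<in> {1..int n} \<inter> D} \<union> {w}"
  have bw: "bij w" and eq: "equivariant n w" using w by (auto simp: carrier_affine_sym)
  have w'w: "w' (w j) = j" and ww': "w (w' j) = j" for j
    using bw by (simp_all add: w'_def bij_is_inj bij_is_surj surj_f_inv_f)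
  have gap: "gappy D" and perD: "periodic n (\<lambda>i. i \<in> D)"
    using equivariant_descents[OF eq n] by (auto simp: D_def)
  have rr: "r (r j) = j" for j by (simp add: r_def rev_runs_rev_runs[OF gap])
  have u: "u \<in> carrier (affine_sym n)"
    using pop_runs_in_affine_sym[OF n eq] w by (simp add: u_def)
  have inv_u: "inv_into UNIV u = r \<circ> w'"
    by (rule inv_unique_comp) (auto simp: u_def pop_runs_def fun_eq_iff r_def[symmetric] D_def[symmetric] rr ww' w'w)
  have n2: "n \<ge> 2" if "D \<noteq> {}"
    using that descents_one[of w] eq n by (cases "n = 1") (auto simp: D_def)
  have inv_ws: "inv_into UNIV (w \<circ> affine_transposition n i) = affine_transposition n i \<circ> w'"
    if "i \<in> D" for i
  proof (rule inv_unique_comp)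
    have ss: "affine_transposition n i (affine_transposition n i j) = j" for j
      using affine_transposition_comp_self[of n i] n2 that by (metis comp_apply id_apply empty_iff)
    show "w \<circ> affine_transposition n i \<circ> (affine_transposition n i \<circ> w') = id"
      "affine_transposition n i \<circ> w' \<circ> (w \<circ> affine_transposition n i) = id"
      by (auto simp: fun_eq_iff ss ww' w'w)
  qed
  have A: "A \<subseteq> carrier (affine_sym n)"
    using w n2 by (auto simp: A_def intro!: comp_in_affine_sym[OF n] affine_transposition_in_affine_sym)
  have Pop_eq: "Pop (affine_sym n) (affine_simple n) w = \<Sqinter>\<^bsub>?L\<^esub> A"
    unfolding Pop_def right_descents_affine[OF n w] A_def D_def
    by (rule arg_cong[where f = "\<lambda>A. \<Sqinter>\<^bsub>?L\<^esub> A"]) auto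
  have carrier_L: "carrier ?L = carrier (affine_sym n)" by (simp add: right_weak_order_def)
  \<comment> \<open>If the positions were in the order \<open>w' a < w' b\<close>, then
    \<open>r\<close> would have to flip them, so they would share a block; but \<open>w\<close>
    decreases along blocks, against \<open>a < b\<close>.\<close>
  have u_inv: "w' b < w' a \<and> \<not> {w' b..<w' a} \<subseteq> D"
    if ab: "a < b" "r (w' b) < r (w' a)" for a b
  proof -
    have "w' a \<noteq> w' b" using ab by auto
    moreover have False if less: "w' a < w' b"
    proof -
      have sub: "{w' a..<w' b} \<subseteq> D"
        using rev_runs_less_iff[OF gap less] ab(2) by (auto simp: r_def)
      have "w (w' b) < w (w' a)"
        by (rule decreasing_on_interval[of _ _ w, OF less]) (use sub in \<open>auto simp: D_def descents_def\<close>)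
      then show False using ab by (simp add: ww')
    qed
    ultimately have "w' b < w' a" by force
    then show ?thesis using rev_runs_less_iff[OF gap] ab(2) by (auto simp: r_def)
  qed
  have lower: "u \<sqsubseteq>\<^bsub>?L\<^esub> x" if x: "x \<in> A" for x
  proof -
    have "inversions (r \<circ> w') \<subseteq> inversions (inv_into UNIV x)"
    proof clarify
      fix a b assume "(a, b) \<in> inversions (r \<circ> w')"
      then have ab: "a < b" "r (w' b) < r (w' a)" by (auto simp: inversions_def)
      from x consider "x = w" | i where "i \<in> D" "x = w \<circ> affine_transposition n i"
        by (auto simp: A_def)
      then show "(a, b) \<in> inversions (inv_into UNIV x)"
      proof cases
        case 1
        then show ?thesis using u_inv[OF ab] ab by (simp add: inversions_def w'_def)
      next
        case 2
        \<comment> \<open>The transposition could only flip these positions if they were neighbours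
          tied by a descent, and then they would lie in one block.\<close>
        have "\<not> ([w' b = i] (mod int n) \<and> w' a = w' b + 1)"
        proof
          assume c: "[w' b = i] (mod int n) \<and> w' a = w' b + 1"
          then have "w' b \<in> D"
            using 2 periodic_mod[OF perD] by (metis cong_def)
          moreover have "{w' b..<w' a} = {w' b}" using c by auto
          ultimately show False using u_inv[OF ab] by simp
        qed
        then have "affine_transposition n i (w' b) < affine_transposition n i (w' a)"
          using u_inv[OF ab] n2 2 by (intro affine_transposition_less) auto
        then show ?thesis using ab 2 inv_ws by (simp add: inversions_def)
      qed
    qed
    then show ?thesis
      using right_weak_order_affine_iff[OF n u] A x by (auto simp: inv_u)
  qed
  have greatest_u: "z \<sqsubseteq>\<^bsub>?L\<^esub> u"
    if z: "z \<in> carrier (affine_sym n)" and zA: "\<And>x. x \<in> A \<Longrightarrow> z \<sqsubseteq>\<^bsub>?L\<^esub> x" for z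
  proof -
    define z' where "z' = inv_into UNIV z"
    have sub: "inversions z' \<subseteq> inversions (inv_into UNIV x)" if "x \<in> A" for x
      using right_weak_order_affine_iff[OF n z, of x] zA[OF that] A that by (auto simp: z'_def)
    have inj_z': "z' a \<noteq> z' b" if "a \<noteq> b" for a b
      using z that unfolding z'_def carrier_affine_sym by (metis bij_is_surj surj_f_inv_f)
    have "inversions z' \<subseteq> inversions (r \<circ> w')"
    proof clarify
      fix a b assume ab: "(a, b) \<in> inversions z'"
      have "w \<in> A" by (simp add: A_def)
      from sub[OF this] ab have less: "w' b < w' a" "a < b" "z' b < z' a"
        by (auto simp: inversions_def w'_def)
      have "\<not> {w' b..<w' a} \<subseteq> D"
      proof
        assume run: "{w' b..<w' a} \<subseteq> D"
        \<comment> \<open>\<open>z' \<circ> w\<close> decreases at each step of the block, as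
          \<open>w\<close> does, because the product with the transposition at that step does not
          invert the two values.\<close>
        have "(z' \<circ> w) (w' a) < (z' \<circ> w) (w' b)"
        proof (rule decreasing_on_interval[of _ _ "z' \<circ> w", OF less(1)])
          fix j assume "j \<in> {w' b..<w' a}"
          then have j: "j \<in> D" using run by blast
          then have wj: "w (j + 1) < w j" by (simp add: D_def descents_def)
          \<comment> \<open>Generators are indexed by \<open>1..n\<close>, so the descent
            \<open>j\<close> is moved to its representative there.\<close>
          define i where "i = (j - 1) mod int n + 1"
          have i_eq: "i = j + - ((j - 1) div int n) * int n"
            by (simp add: i_def minus_div_mult_eq_mod[symmetric])
          have i: "i \<in> {1..int n}" using n by (simp add: i_def add1_zle_eq)
          have iD: "i \<in> D" unfolding i_eq using periodic_add_mult[OF perD] j by blast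
          have cong: "[j = i] (mod int n)" 
            unfolding i_eq cong_def by (rule mod_mult_self1[symmetric])
          have s: "affine_transposition n i j = j + 1" "affine_transposition n i (j + 1) = j"
            using affine_transposition_simps[OF _ cong] n2 iD by auto
          have "w \<circ> affine_transposition n i \<in> A" using i iD by (auto simp: A_def)
          from sub[OF this] have "inversions z' \<subseteq> inversions (affine_transposition n i \<circ> w')"
            by (simp add: inv_ws[OF iD])
          moreover have "(w (j + 1), w j) \<notin> inversions (affine_transposition n i \<circ> w')"
            by (simp add: inversions_def w'w s)
          ultimately have "(w (j + 1), w j) \<notin> inversions z'" by blast
          then have "\<not> z' (w j) < z' (w (j + 1))" using wj by (simp add: inversions_def)
          then show "(z' \<circ> w) (j + 1) < (z' \<circ> w) j"
            using inj_z'[of "w j" "w (j + 1)"] wj by simp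
        qed
        then show False using less by (simp add: ww')
      qed
      then show "(a, b) \<in> inversions (r \<circ> w')"
        using rev_runs_less_iff[OF gap less(1)] less(2) by (simp add: inversions_def r_def)
    qed
    then show ?thesis
      using right_weak_order_affine_iff[OF n z u] by (simp add: inv_u z'_def)
  qed
  have Lower: "Lower ?L A = {z \<in> carrier (affine_sym n). \<forall>x\<in>A. z \<sqsubseteq>\<^bsub>?L\<^esub> x}"
    using A by (auto simp: Lower_def carrier_L)
  have great: "greatest ?L u (Lower ?L A)"
    unfolding greatest_def Lower carrier_L using u lower greatest_u by auto
  have "\<Sqinter>\<^bsub>?L\<^esub> A = u"
    \<comment> \<open>The infimum is a choice among greatest lower bounds; antisymmetry leaves only
      \<open>u\<close>.\<close>
    unfolding inf_def
  proof (rule some_equality[of "\<lambda>x. greatest ?L x (Lower ?L A)", OF great])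
    fix v assume v: "greatest ?L v (Lower ?L A)"
    then have v': "v \<in> carrier (affine_sym n)" by (auto simp: greatest_def Lower)
    have "u \<sqsubseteq>\<^bsub>?L\<^esub> v" "v \<sqsubseteq>\<^bsub>?L\<^esub> u"
      using great v by (auto simp: greatest_def)
    then have "inversions (inv_into UNIV u) = inversions (inv_into UNIV v)"
      using right_weak_order_affine_iff[OF n] u v' by blast
    then show "v = u" using right_weak_order_affine_antisym[OF n u v'] by simp
  qed
  then show ?thesis using Pop_eq by (simp add: u_def)
qed

text \<open>Membership in the group disappears from the right-hand side, in particular the sum over
  a period, which is not a local condition on codes.\<close>

lemma Pop_preimage_affine_sym:
  assumes n: "n \<ge> 1"
  shows "Pop_preimage (affine_sym n) (affine_simple n) t =
    {w. equivariant n w \<and> (pop_runs ^^ t) w = id}"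
proof -
  have eqv: "equivariant n w" if "w \<in> carrier (affine_sym n)" for w
    using that by (simp add: carrier_affine_sym)
  have iter: "(Pop (affine_sym n) (affine_simple n) ^^ k) w = (pop_runs ^^ k) w \<and>
      (pop_runs ^^ k) w \<in> carrier (affine_sym n)" if "w \<in> carrier (affine_sym n)" for k w
  proof (induction k)
    case (Suc k)
    then show ?case using Pop_affine_sym[OF n] pop_runs_in_affine_sym[OF n] eqv by simp
  qed (use that in simp)
  \<comment> \<open>Membership is pulled back from the identity through one application of
    \<open>pop_runs\<close> at a time.\<close>
  have "w \<in> carrier (affine_sym n)" if "equivariant n w" "(pop_runs ^^ t) w = id" for w
    using that
  proof (induction t arbitrary: w)
    case 0
    then show ?case using id_in_affine_sym by (metis funpow_0)
  next
    case (Suc t)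
    then have "pop_runs w \<in> carrier (affine_sym n)"
      using equivariant_pop_runs[OF _ n]
      by (intro Suc.IH) (auto simp: funpow_Suc_right simp del: funpow.simps)
    then show ?case using pop_runs_in_affine_sym[OF n] Suc.prems by blast
  qed
  then show ?thesis
    using iter eqv by (auto simp: Pop_preimage_def)
qed

theorem theorem1p10:
  fixes t :: nat
  shows "(\<forall>n\<ge>1. finite (Pop_preimage (affine_sym n) (affine_simple n) t)) \<and>
    rational_fps (Abs_fps (\<lambda>n. if n = 0 then 0
      else of_nat (card (Pop_preimage (affine_sym n) (affine_simple n) t))) :: rat fps)"
proof
  show "\<forall>n\<ge>1. finite (Pop_preimage (affine_sym n) (affine_simple n) t)"
    using rational_pop_runs_preimage(1) by (simp add: Pop_preimage_affine_sym)
  have "(\<lambda>n. if n = 0 then 0 else of_nat (card (Pop_preimage (affine_sym n) (affine_simple n) t))) =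
    (\<lambda>n. if n = 0 then 0 else of_nat (card {w. equivariant n w \<and> (pop_runs ^^ t) w = id}) :: rat)"
    by (auto simp: Pop_preimage_affine_sym)
  then show "rational_fps (Abs_fps (\<lambda>n. if n = 0 then 0
      else of_nat (card (Pop_preimage (affine_sym n) (affine_simple n) t))) :: rat fps)"
    using regular_rational_fps_imp_rational[OF rational_pop_runs_preimage(2)] by simp
qed

end
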